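(* Let $m\ge d+2$. One time step $f^n\mapsto f^{n+1}$ (step size $\tau>0$) of the robust and conservative dynamical low-rank integrator described in the context satisfies the following discrete version of the energy continuity equation: $$\frac{e^{n+1}-e^n}{\tau}+\nabla_x\cdot Q^n-E^n\cdot\left(\frac{E^{n+1}-E^n}{\tau}-j^n\right)=\frac{(E^{n+1}-E^n)^2}{2\tau}=\mathcal O(\tau),$$ where, for $l\in\{n,n+1\}$, $E^l=E(f^l)$ and $e^l=\frac12\int_{\Omega_v}v^2f^l\,dv+\frac12(E^l)^2$, and where $j^n=\int_{\Omega_v}vf^n\,dv$ and $Q^n=\frac12\int_{\Omega_v}v\,v^2f^n\,dv$.
   Context: **Problem.** $\Omega=\Omega_x\times\Omega_v$ with $\Omega_x,\Omega_v\subset\mathbb R^d$. The Vlasov--Poisson equations are $\partial_t f=\mathrm{RHS}[f]$ with $\mathrm{RHS}[f]=-v\cdot\nabla_x f+E(f)\cdot\nabla_v f$, where $E(f)=-\nabla_x\phi$ and $-\Delta_x\phi=1-\int_{\Omega_v} f\,dv$ (so $\nabla_x\cdot E(f)=1-\int_{\Omega_v} f\,dv$). $\Omega_x$ is a box with periodic boundary conditions and $\int_{\Omega} f\,d(x,v)=|\Omega_x|$. All functions are sufficiently smooth, and sufficiently decaying in $v$, so that all integrals below exist; $\int_{\Omega_x}\nabla_x u\,dx=0$, and integration by parts in $v$ produces no boundary terms. Space and velocity are kept continuous. **Notation.** For vectors, $v^2=\sum_iv_i^2$ and $E^2=\sum_iE_i^2$ denote squared Euclidean norms. $\mathcal O(\tau)$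 refers to $\tau\to0$ with $f^n$ (and its low-rank factors) fixed. $f_{0v}>0$ is a weight function on $\Omega_v$ decaying fast enough that $1$, the components $v_1,\dots,v_d$ of $v$, and $v^2$ lie in $L^2(\Omega_v,f_{0v})$. Set $\langle a,b\rangle_x=\int_{\Omega_x}ab\,dx$, $\langle a,b\rangle_v=\int_{\Omega_v}f_{0v}\,ab\,dv$, $\|w\|=\sqrt{\langle w,w\rangle_v}$, $(a,b)_v=\int_{\Omega_v}ab\,dv$, $(a,b)_{xv}=\int_\Omega ab\,d(x,v)$. **Low-rank representation.** $f^n=f_{0v}\sum_{i,j=1}^r X_i^n(x)S_{ij}^nV_j^n(v)$ with $S^n\in\mathbb R^{r\times r}$, $(X_i^n)_i$ orthonormal for $\langle\cdot,\cdot\rangle_x$, $(V_j^n)_j$ orthonormal for $\langle\cdot,\cdot\rangle_v$. The first $m\le r$ functions are fixed in time: $V_a^n=U_a$ for $1\le a\le m$; the others are $V_p^n=W_p^n$ for $m<p\le r$. The first fixed functions are $U_1=1/\|1\|$, $U_{s+1}=v_s/\|v_s\|$ ($1\le s\le d$), $U_{d+2}=(v^2-c)/\|v^2-c\|$ with $c$ the constant making $v^2-c$ orthogonal to $1$ in $\langle\cdot,\cdot\rangle_v$ ($c=1$ for $d=1$, $f_{0v}=e^{-v^2/2}$, $\Omega_v=\mathbb R$); the weight is such that the $U_a$ are orthonormal. **One step of the integrator** (Algorithm 1), with $\mathrm{RHS}^n=\mathrm{RHS}[f^n]$: 1. Set $K_k^n=\sum_iX_i^nS_{ik}^n$ and $K_k^{n+1}=K_k^n+\tau(V_k^n,\mathrm{RHS}^n)_v$,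 $1\le k\le r$. Set $L_q^n=\sum_{i=1}^r\sum_{p=m+1}^r S_{iq}^nS_{ip}^nW_p^n$ and $L_q^{n+1}=L_q^n+\frac{\tau}{f_{0v}}\sum_iS_{iq}^n\langle X_i^n,\mathrm{RHS}^n\rangle_x-\tau\sum_{i,l}S_{iq}^n(X_i^nV_l^n,\mathrm{RHS}^n)_{xv}V_l^n$, $m+1\le q\le r$. 2. $(\widetilde X_k^{n+1})_k$ is an orthonormal basis (for $\langle\cdot,\cdot\rangle_x$) of the span of all $X_i^n$, all components of all $\nabla_xX_i^n$, and all $K_i^{n+1}$. 3. $(\widetilde V_l^{n+1})_l$ is an orthonormal basis (for $\langle\cdot,\cdot\rangle_v$) of the span of all $U_a$, $L_q^{n+1}$, $W_p^n$, chosen such that $\widetilde V_a^{n+1}=U_a$ for $a\le m$; denote the remaining functions by $\widetilde W^{n+1}$. 4. With $M_{ki}=\langle\widetilde X_k^{n+1},X_i^n\rangle_x$, $N^T_{jl}=\langle V_j^n,\widetilde V_l^{n+1}\rangle_v$ and $g=f_{0v}\sum_{k,i,j,l}\widetilde X_k^{n+1}M_{ki}S_{ij}^nN^T_{jl}\widetilde V_l^{n+1}$, set $\widetilde S_{kl}^{n+1}=\sum_{i,j}M_{ki}S_{ij}^nN^T_{jl}+\tau(\widetilde X_k^{n+1}\widetilde V_l^{n+1},\mathrm{RHS}[g])_{xv}$. 5. (Truncation to rank $r$.) Regarding families of functions as matrices whose columns are the functions, set $\widetilde K=\widetilde X^{n+1}\widetilde S^{n+1}=[\widetilde K^{cons}\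 \widetilde K^{rem}]$, where $\widetilde K^{cons}$ consists of the first $m$ columns. Take QR decompositions (first factor with orthonormal columns) $\widetilde K^{cons}=X^{cons}S^{cons}$, $\widetilde K^{rem}=\widetilde X^{rem}\widetilde S^{rem}$. Let $\hat U\hat S\hat W^T$ be the singular value decomposition of $\widetilde S^{rem}$ truncated to the $r-m$ largest singular values; set $X^{rem}=\widetilde X^{rem}\hat U$, $S^{rem}=\hat S$, $W^{n+1}=\widetilde W^{n+1}\hat W$, $V^{n+1}=[U\ W^{n+1}]$. Take a QR decomposition $[X^{cons}\ X^{rem}]=X^{n+1}R$ and set $S^{n+1}=R\begin{bmatrix}S^{cons}&0\\0&S^{rem}\end{bmatrix}$. 6. $f^{n+1}=f_{0v}\sum_{i,j=1}^rX_i^{n+1}S_{ij}^{n+1}V_j^{n+1}$. *)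

theory Defs
  imports "HOL-Analysis.Analysis"
begin

subsection \<open>Differential operators\<close>

definition partial :: "'d::finite \<Rightarrow> (real^'d \<Rightarrow> real) \<Rightarrow> real^'d \<Rightarrow> real" where
  "partial s f x = frechet_derivative f (at x) (axis s 1)"

definition grad :: "(real^'d::finite \<Rightarrow> real) \<Rightarrow> real^'d \<Rightarrow> real^'d" where
  "grad f x = (\<chi> s. partial s f x)"

definition divergence :: "(real^'d::finite \<Rightarrow> real^'d) \<Rightarrow> real^'d \<Rightarrow> real" where
  "divergence F x = (\<Sum>s\<in>UNIV. partial s (\<lambda>y. F y $ s) x)"

(* meant for open S *)
definition C1_on :: "(real^'d::finite) set \<Rightarrow> (real^'d \<Rightarrow> real) \<Rightarrow> bool" where
  "C1_on S f \<longleftrightarrow> (\<forall>x\<in>S. f differentiable (at x)) \<and> continuous_on S (grad f)"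

definition C2_on :: "(real^'d::finite) set \<Rightarrow> (real^'d \<Rightarrow> real) \<Rightarrow> bool" where
  "C2_on S f \<longleftrightarrow> C1_on S f \<and> (\<forall>s. C1_on S (partial s f))"

(* Functions of x live on the whole space and are periodic with the period box cbox lo hi. *)
definition box_periodic :: "real^'d::finite \<Rightarrow> real^'d \<Rightarrow> (real^'d \<Rightarrow> real) \<Rightarrow> bool" where
  "box_periodic lo hi f \<longleftrightarrow> (\<forall>x s. f (x + (hi $ s - lo $ s) *\<^sub>R axis s 1) = f x)"


subsection \<open>Weighted L2 inner products and function families\<close>

text \<open>The space inner product is the case of the box with weight 1, the velocity inner product
  the case of the velocity domain with the weight f0v.\<close>

definition inner_L2 ::
  "'a::euclidean_space set \<Rightarrow> ('a \<Rightarrow> real) \<Rightarrow> ('a \<Rightarrow> real) \<Rightarrow> ('a \<Rightarrow> real) \<Rightarrow> real" where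
  "inner_L2 \<Omega> w a b = (LINT z:\<Omega>|lborel. w z * a z * b z)"

definition norm_L2 :: "'a::euclidean_space set \<Rightarrow> ('a \<Rightarrow> real) \<Rightarrow> ('a \<Rightarrow> real) \<Rightarrow> real" where
  "norm_L2 \<Omega> w a = sqrt (inner_L2 \<Omega> w a a)"

definition in_L2 :: "'a::euclidean_space set \<Rightarrow> ('a \<Rightarrow> real) \<Rightarrow> ('a \<Rightarrow> real) \<Rightarrow> bool" where
  "in_L2 \<Omega> w a \<longleftrightarrow> set_borel_measurable lborel \<Omega> a \<and> set_integrable lborel \<Omega> (\<lambda>z. w z * (a z)\<^sup>2)"

definition orthonormal_family ::
  "'a::euclidean_space set \<Rightarrow> ('a \<Rightarrow> real) \<Rightarrow> nat set \<Rightarrow> (nat \<Rightarrow> 'a \<Rightarrow> real) \<Rightarrow> bool" where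
  "orthonormal_family \<Omega> w I F \<longleftrightarrow>
     (\<forall>i\<in>I. in_L2 \<Omega> w (F i)) \<and>
     (\<forall>i\<in>I. \<forall>j\<in>I. inner_L2 \<Omega> w (F i) (F j) = (if i = j then 1 else 0))"

(* Linear span of G, functions being identified when they agree on D. *)
definition fun_span :: "'a set \<Rightarrow> ('a \<Rightarrow> real) set \<Rightarrow> ('a \<Rightarrow> real) set" where
  "fun_span D G =
     {h. \<exists>T c. finite T \<and> T \<subseteq> G \<and> (\<forall>z\<in>D. h z = (\<Sum>g\<in>T. c g * g z))}"

(* D is the domain of the functions, \<Omega> the domain of integration: they differ in x, where
   D = UNIV and \<Omega> is the period box. *)
definition orthonormal_basis ::
  "'a::euclidean_space set \<Rightarrow> 'a set \<Rightarrow> ('a \<Rightarrow> real) \<Rightarrow> nat set \<Rightarrow> (nat \<Rightarrow> 'a \<Rightarrow> real)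
     \<Rightarrow> ('a \<Rightarrow> real) set \<Rightarrow> bool" where
  "orthonormal_basis D \<Omega> w I F G \<longleftrightarrow>
     orthonormal_family \<Omega> w I F \<and> fun_span D (F ` I) = fun_span D G"

(* Thin QR decomposition A = Q R of the matrix whose columns are the functions A j, j in I. *)
definition is_QR ::
  "'a::euclidean_space set \<Rightarrow> 'a set \<Rightarrow> ('a \<Rightarrow> real) \<Rightarrow> nat set \<Rightarrow> (nat \<Rightarrow> 'a \<Rightarrow> real)
     \<Rightarrow> (nat \<Rightarrow> 'a \<Rightarrow> real) \<Rightarrow> (nat \<Rightarrow> nat \<Rightarrow> real) \<Rightarrow> bool" where
  "is_QR D \<Omega> w I A Q R \<longleftrightarrow>
     orthonormal_family \<Omega> w I Q \<and>
     (\<forall>j\<in>I. \<forall>z\<in>D. A j z = (\<Sum>i\<in>I. Q i z * R i j)) \<and>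
     (\<forall>i\<in>I. \<forall>j\<in>I. j < i \<longrightarrow> R i j = 0)"

(* Singular value decomposition P diag(\<sigma>) Q^T of the square matrix A with index set I,
   singular values in decreasing order. *)
definition is_SVD ::
  "nat set \<Rightarrow> (nat \<Rightarrow> nat \<Rightarrow> real) \<Rightarrow> (nat \<Rightarrow> nat \<Rightarrow> real) \<Rightarrow> (nat \<Rightarrow> real)
     \<Rightarrow> (nat \<Rightarrow> nat \<Rightarrow> real) \<Rightarrow> bool" where
  "is_SVD I A P \<sigma> Q \<longleftrightarrow>
     (\<forall>i\<in>I. \<forall>j\<in>I. A i j = (\<Sum>k\<in>I. P i k * \<sigma> k * Q j k)) \<and>
     (\<forall>k\<in>I. \<forall>l\<in>I. (\<Sum>i\<in>I. P i k * P i l) = (if k = l then 1 else 0)) \<and>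
     (\<forall>k\<in>I. \<forall>l\<in>I. (\<Sum>i\<in>I. Q i k * Q i l) = (if k = l then 1 else 0)) \<and>
     (\<forall>k\<in>I. 0 \<le> \<sigma> k) \<and>
     (\<forall>k\<in>I. \<forall>l\<in>I. k \<le> l \<longrightarrow> \<sigma> l \<le> \<sigma> k)"


subsection \<open>Vlasov--Poisson\<close>

definition is_efield ::
  "real^'d::finite \<Rightarrow> real^'d \<Rightarrow> (real^'d) set \<Rightarrow> (real^'d \<Rightarrow> real^'d \<Rightarrow> real)
     \<Rightarrow> (real^'d \<Rightarrow> real^'d) \<Rightarrow> bool" where
  "is_efield lo hi \<Omega>v f E \<longleftrightarrow>
     (\<exists>\<phi>. C2_on UNIV \<phi> \<and> box_periodic lo hi \<phi> \<and>
        (\<forall>x. E x = - grad \<phi> x) \<and>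
        (\<forall>x. - divergence (grad \<phi>) x = 1 - (LINT v:\<Omega>v|lborel. f x v)))"

definition poisson_solvable ::
  "real^'d::finite \<Rightarrow> real^'d \<Rightarrow> (real^'d) set \<Rightarrow> (real^'d \<Rightarrow> real^'d \<Rightarrow> real) \<Rightarrow> bool" where
  "poisson_solvable lo hi \<Omega>v f \<longleftrightarrow> (\<exists>E. is_efield lo hi \<Omega>v f E)"

(* The potential of a periodic problem is unique up to a constant, so there is at most one field. *)
definition efield ::
  "real^'d::finite \<Rightarrow> real^'d \<Rightarrow> (real^'d) set \<Rightarrow> (real^'d \<Rightarrow> real^'d \<Rightarrow> real)
     \<Rightarrow> real^'d \<Rightarrow> real^'d" where
  "efield lo hi \<Omega>v f = (SOME E. is_efield lo hi \<Omega>v f E)"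

definition vp_rhs ::
  "real^'d::finite \<Rightarrow> real^'d \<Rightarrow> (real^'d) set \<Rightarrow> (real^'d \<Rightarrow> real^'d \<Rightarrow> real)
     \<Rightarrow> real^'d \<Rightarrow> real^'d \<Rightarrow> real" where
  "vp_rhs lo hi \<Omega>v f x v =
     - (v \<bullet> grad (\<lambda>y. f y v) x) + efield lo hi \<Omega>v f x \<bullet> grad (f x) v"

definition current ::
  "(real^'d::finite) set \<Rightarrow> (real^'d \<Rightarrow> real^'d \<Rightarrow> real) \<Rightarrow> real^'d \<Rightarrow> real^'d" where
  "current \<Omega>v f x = (LINT v:\<Omega>v|lborel. f x v *\<^sub>R v)"

definition energy_flux ::
  "(real^'d::finite) set \<Rightarrow> (real^'d \<Rightarrow> real^'d \<Rightarrow> real) \<Rightarrow> real^'d \<Rightarrow> real^'d" where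
  "energy_flux \<Omega>v f x = (1/2) *\<^sub>R (LINT v:\<Omega>v|lborel. ((norm v)\<^sup>2 * f x v) *\<^sub>R v)"

definition energy_density ::
  "real^'d::finite \<Rightarrow> real^'d \<Rightarrow> (real^'d) set \<Rightarrow> (real^'d \<Rightarrow> real^'d \<Rightarrow> real)
     \<Rightarrow> real^'d \<Rightarrow> real" where
  "energy_density lo hi \<Omega>v f x =
     (1/2) * (LINT v:\<Omega>v|lborel. (norm v)\<^sup>2 * f x v) + (1/2) * (norm (efield lo hi \<Omega>v f x))\<^sup>2"

definition ibp_no_boundary ::
  "(real^'d::finite) set \<Rightarrow> (real^'d \<Rightarrow> real) \<Rightarrow> (real^'d \<Rightarrow> real) \<Rightarrow> bool" where
  "ibp_no_boundary \<Omega>v a h \<longleftrightarrow>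
     (\<forall>s. (LINT v:\<Omega>v|lborel. a v * partial s h v) = - (LINT v:\<Omega>v|lborel. partial s a v * h v))"


subsection \<open>Low-rank representation\<close>

text \<open>Families and matrices are indexed from 1; only indices within the stated ranges matter.\<close>

definition low_rank ::
  "(real^'d::finite \<Rightarrow> real) \<Rightarrow> nat \<Rightarrow> nat \<Rightarrow> (nat \<Rightarrow> real^'d \<Rightarrow> real) \<Rightarrow> (nat \<Rightarrow> nat \<Rightarrow> real)
     \<Rightarrow> (nat \<Rightarrow> real^'d \<Rightarrow> real) \<Rightarrow> real^'d \<Rightarrow> real^'d \<Rightarrow> real" where
  "low_rank f0v p q X S V x v = f0v v * (\<Sum>i=1..p. \<Sum>j=1..q. X i x * S i j * V j v)"

(* The family [U W]: U a for a <= m, W p for p > m. *)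
definition join_at :: "nat \<Rightarrow> (nat \<Rightarrow> 'a) \<Rightarrow> (nat \<Rightarrow> 'a) \<Rightarrow> nat \<Rightarrow> 'a" where
  "join_at m U W j = (if j \<le> m then U j else W j)"

(* An enumeration idx of the coordinates turns v_1, ..., v_d into v $ idx 1, ..., v $ idx d. *)
definition conserved_basis ::
  "(real^'d::finite) set \<Rightarrow> (real^'d \<Rightarrow> real) \<Rightarrow> (nat \<Rightarrow> 'd) \<Rightarrow> real
     \<Rightarrow> (nat \<Rightarrow> real^'d \<Rightarrow> real) \<Rightarrow> bool" where
  "conserved_basis \<Omega>v f0v idx c U \<longleftrightarrow>
     bij_betw idx {1..CARD('d)} UNIV \<and>
     inner_L2 \<Omega>v f0v (\<lambda>v. (norm v)\<^sup>2 - c) (\<lambda>v. 1) = 0 \<and>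
     (\<forall>v\<in>\<Omega>v. U 1 v = 1 / norm_L2 \<Omega>v f0v (\<lambda>v. 1)) \<and>
     (\<forall>s\<in>{1..CARD('d)}. \<forall>v\<in>\<Omega>v.
        U (s + 1) v = v $ idx s / norm_L2 \<Omega>v f0v (\<lambda>v. v $ idx s)) \<and>
     (\<forall>v\<in>\<Omega>v. U (CARD('d) + 2) v =
        ((norm v)\<^sup>2 - c) / norm_L2 \<Omega>v f0v (\<lambda>v. (norm v)\<^sup>2 - c))"


subsection \<open>One step of the integrator\<close>

definition inner_xv ::
  "real^'d::finite \<Rightarrow> real^'d \<Rightarrow> (real^'d) set \<Rightarrow> (real^'d \<Rightarrow> real^'d \<Rightarrow> real)
     \<Rightarrow> (real^'d \<Rightarrow> real^'d \<Rightarrow> real) \<Rightarrow> real" where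
  "inner_xv lo hi \<Omega>v a b =
     (LINT z:(cbox lo hi \<times> \<Omega>v)|lborel. a (fst z) (snd z) * b (fst z) (snd z))"

definition K_step ::
  "(real^'d::finite) set \<Rightarrow> nat \<Rightarrow> real \<Rightarrow> (nat \<Rightarrow> real^'d \<Rightarrow> real) \<Rightarrow> (nat \<Rightarrow> nat \<Rightarrow> real)
     \<Rightarrow> (nat \<Rightarrow> real^'d \<Rightarrow> real) \<Rightarrow> (real^'d \<Rightarrow> real^'d \<Rightarrow> real) \<Rightarrow> nat \<Rightarrow> real^'d \<Rightarrow> real" where
  "K_step \<Omega>v r \<tau> X S V F k x =
     (\<Sum>i=1..r. X i x * S i k) + \<tau> * (LINT v:\<Omega>v|lborel. V k v * F x v)"

definition L_step ::
  "real^'d::finite \<Rightarrow> real^'d \<Rightarrow> (real^'d) set \<Rightarrow> (real^'d \<Rightarrow> real) \<Rightarrow> nat \<Rightarrow> nat \<Rightarrow> real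
     \<Rightarrow> (nat \<Rightarrow> real^'d \<Rightarrow> real) \<Rightarrow> (nat \<Rightarrow> nat \<Rightarrow> real) \<Rightarrow> (nat \<Rightarrow> real^'d \<Rightarrow> real)
     \<Rightarrow> (real^'d \<Rightarrow> real^'d \<Rightarrow> real) \<Rightarrow> nat \<Rightarrow> real^'d \<Rightarrow> real" where
  "L_step lo hi \<Omega>v f0v m r \<tau> X S V F q v =
     (\<Sum>i=1..r. \<Sum>p=m+1..r. S i q * S i p * V p v)
     + \<tau> / f0v v * (\<Sum>i=1..r. S i q * inner_L2 (cbox lo hi) (\<lambda>x. 1) (X i) (\<lambda>x. F x v))
     - \<tau> * (\<Sum>i=1..r. \<Sum>l=1..r. S i q * inner_xv lo hi \<Omega>v (\<lambda>x v. X i x * V l v) F * V l v)"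

(* The coefficients M S N^T of the old solution in the augmented bases Xt, Vt. *)
definition S_proj ::
  "real^'d::finite \<Rightarrow> real^'d \<Rightarrow> (real^'d) set \<Rightarrow> (real^'d \<Rightarrow> real) \<Rightarrow> nat
     \<Rightarrow> (nat \<Rightarrow> real^'d \<Rightarrow> real) \<Rightarrow> (nat \<Rightarrow> nat \<Rightarrow> real) \<Rightarrow> (nat \<Rightarrow> real^'d \<Rightarrow> real)
     \<Rightarrow> (nat \<Rightarrow> real^'d \<Rightarrow> real) \<Rightarrow> (nat \<Rightarrow> real^'d \<Rightarrow> real) \<Rightarrow> nat \<Rightarrow> nat \<Rightarrow> real" where
  "S_proj lo hi \<Omega>v f0v r X S V Xt Vt k l =
     (\<Sum>i=1..r. \<Sum>j=1..r. inner_L2 (cbox lo hi) (\<lambda>x. 1) (Xt k) (X i) * S i j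
                            * inner_L2 \<Omega>v f0v (V j) (Vt l))"

definition S_step ::
  "real^'d::finite \<Rightarrow> real^'d \<Rightarrow> (real^'d) set \<Rightarrow> (real^'d \<Rightarrow> real) \<Rightarrow> nat \<Rightarrow> nat \<Rightarrow> nat \<Rightarrow> real
     \<Rightarrow> (nat \<Rightarrow> real^'d \<Rightarrow> real) \<Rightarrow> (nat \<Rightarrow> nat \<Rightarrow> real) \<Rightarrow> (nat \<Rightarrow> real^'d \<Rightarrow> real)
     \<Rightarrow> (nat \<Rightarrow> real^'d \<Rightarrow> real) \<Rightarrow> (nat \<Rightarrow> real^'d \<Rightarrow> real) \<Rightarrow> nat \<Rightarrow> nat \<Rightarrow> real" where
  "S_step lo hi \<Omega>v f0v r p q \<tau> X S V Xt Vt k l =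
     S_proj lo hi \<Omega>v f0v r X S V Xt Vt k l
     + \<tau> * inner_xv lo hi \<Omega>v (\<lambda>x v. Xt k x * Vt l v)
             (vp_rhs lo hi \<Omega>v
                (low_rank f0v p q Xt (S_proj lo hi \<Omega>v f0v r X S V Xt Vt) Vt))"

(* The columns of Xt St split into 1..m (conservative part) and m+1..q (remainder). The matrices of
   the remainder keep the indices m+1..q, so its r-m largest singular values are those with index in
   m+1..r. In the use below q >= r, since the augmented span contains the r old functions. *)
definition truncation ::
  "real^'d::finite \<Rightarrow> real^'d \<Rightarrow> (real^'d) set \<Rightarrow> nat \<Rightarrow> nat \<Rightarrow> nat \<Rightarrow> nat
     \<Rightarrow> (nat \<Rightarrow> real^'d \<Rightarrow> real) \<Rightarrow> (nat \<Rightarrow> nat \<Rightarrow> real) \<Rightarrow> (nat \<Rightarrow> real^'d \<Rightarrow> real)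
     \<Rightarrow> (nat \<Rightarrow> real^'d \<Rightarrow> real) \<Rightarrow> (nat \<Rightarrow> nat \<Rightarrow> real) \<Rightarrow> (nat \<Rightarrow> real^'d \<Rightarrow> real) \<Rightarrow> bool" where
  "truncation lo hi \<Omega>v m r p q Xt St Wt X1 S1 W1 \<longleftrightarrow>
     (\<exists>Xcons Scons Xtrem Strem P \<sigma> Q R.
        let Kt = (\<lambda>l x. \<Sum>k=1..p. Xt k x * St k l);
            Xrem = (\<lambda>j x. \<Sum>i=m+1..q. Xtrem i x * P i j);
            B = (\<lambda>k j. if k \<le> m \<and> j \<le> m then Scons k j
                       else if k = j then \<sigma> k else 0)
        in is_QR UNIV (cbox lo hi) (\<lambda>x. 1) {1..m} Kt Xcons Scons \<and>
           is_QR UNIV (cbox lo hi) (\<lambda>x. 1) {m+1..q} Kt Xtrem Strem \<and>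
           is_SVD {m+1..q} Strem P \<sigma> Q \<and>
           (\<forall>j\<in>{m+1..r}. \<forall>v\<in>\<Omega>v. W1 j v = (\<Sum>l=m+1..q. Wt l v * Q l j)) \<and>
           is_QR UNIV (cbox lo hi) (\<lambda>x. 1) {1..r} (join_at m Xcons Xrem) X1 R \<and>
           (\<forall>i\<in>{1..r}. \<forall>j\<in>{1..r}. S1 i j = (\<Sum>k=1..r. R i k * B k j)))"

(* A relation, as neither the bases nor the decompositions are unique. *)
definition dlr_step ::
  "real^'d::finite \<Rightarrow> real^'d \<Rightarrow> (real^'d) set \<Rightarrow> (real^'d \<Rightarrow> real) \<Rightarrow> nat \<Rightarrow> nat
     \<Rightarrow> (nat \<Rightarrow> real^'d \<Rightarrow> real) \<Rightarrow> real
     \<Rightarrow> (nat \<Rightarrow> real^'d \<Rightarrow> real) \<Rightarrow> (nat \<Rightarrow> nat \<Rightarrow> real) \<Rightarrow> (nat \<Rightarrow> real^'d \<Rightarrow> real)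
     \<Rightarrow> (nat \<Rightarrow> real^'d \<Rightarrow> real) \<Rightarrow> (nat \<Rightarrow> nat \<Rightarrow> real) \<Rightarrow> (nat \<Rightarrow> real^'d \<Rightarrow> real) \<Rightarrow> bool" where
  "dlr_step lo hi \<Omega>v f0v m r U \<tau> X S W X1 S1 W1 \<longleftrightarrow>
     (\<exists>p q Xt Wt.
        let V = join_at m U W;
            Vt = join_at m U Wt;
            F = vp_rhs lo hi \<Omega>v (low_rank f0v r r X S V)
        in orthonormal_basis UNIV (cbox lo hi) (\<lambda>x. 1) {1..p} Xt
             (X ` {1..r} \<union> (\<Union>s. (\<lambda>i. partial s (X i)) ` {1..r})
                \<union> K_step \<Omega>v r \<tau> X S V F ` {1..r}) \<and>
           m \<le> q \<and>
           orthonormal_basis \<Omega>v \<Omega>v f0v {1..q} Vt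
             (U ` {1..m} \<union> L_step lo hi \<Omega>v f0v m r \<tau> X S V F ` {m+1..r} \<union> W ` {m+1..r}) \<and>
           truncation lo hi \<Omega>v m r p q Xt (S_step lo hi \<Omega>v f0v r p q \<tau> X S V Xt Vt) Wt X1 S1 W1)"

end

theory Submission
  imports Defs
begin

text \<open>
  The discrete energy law comes from an exact statement about velocity moments. Let \<open>a\<close> be a
  combination of the fixed functions \<open>U\<^sub>b\<close>, \<open>b \<le> m\<close>; then the moment of \<open>f\<close> against \<open>a\<close> makes an explicit
  Euler step, \<open>\<integral> a f\<^sup>n\<^sup>+\<^sup>1 dv = \<integral> a f\<^sup>n dv + \<tau> \<integral> a RHS[f\<^sup>n] dv\<close> (\<open>dlr_step_moment\<close>). The reasons are:
  the augmented bases contain the old ones, so that the Galerkin step evaluates the right-hand side at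
  \<open>f\<^sup>n\<close> itself (\<open>projected_solution_eq\<close>); the column of the Galerkin solution that belongs to \<open>U\<^sub>b\<close> is
  the projection of \<open>K\<^sub>b\<^sup>n\<^sup>+\<^sup>1\<close> to a span that contains \<open>K\<^sub>b\<^sup>n\<^sup>+\<^sup>1\<close>; the truncation keeps these columns; and
  all other velocity functions of \<open>f\<^sup>n\<^sup>+\<^sup>1\<close> are orthogonal to the \<open>U\<^sub>b\<close> (\<open>dlr_step_K\<close>).

  Both \<open>1\<close> and \<open>v\<^sup>2\<close> are such combinations. For \<open>a = v\<^sup>2/2\<close>, the moment of the right-hand side is
  \<open>- \<nabla>\<cdot>Q\<^sup>n - E\<^sup>n\<cdot>j\<^sup>n\<close> (\<open>energy_moment\<close>), and the identity follows from
  \<open>\<bar>E\<^sup>n\<^sup>+\<^sup>1\<bar>\<^sup>2 - \<bar>E\<^sup>n\<bar>\<^sup>2 = \<bar>E\<^sup>n\<^sup>+\<^sup>1 - E\<^sup>n\<bar>\<^sup>2 + 2 E\<^sup>n\<cdot>(E\<^sup>n\<^sup>+\<^sup>1 - E\<^sup>n)\<close>.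

  For \<open>a = 1\<close>, the density changes by \<open>\<tau> H\<close>, where \<open>H\<close> depends on \<open>f\<^sup>n\<close> only. Periodic harmonic functions
  have zero gradient (\<open>periodic_harmonic_partial_zero\<close>), so the field increments of any two steps are in
  the ratio of their step sizes (\<open>efield_increment_unique\<close>). Fields are continuous and periodic, hence
  bounded, so \<open>E\<^sup>n\<^sup>+\<^sup>1 - E\<^sup>n\<close> is at most a constant times \<open>\<tau>\<close>, uniformly in \<open>x\<close> and in the choices made
  in the step.
\<close>

section \<open>Weighted square-integrable functions\<close>

text \<open>A measurable domain of integration with a nonnegative measurable weight.\<close>

locale weighted_L2 =
  fixes \<Omega> :: "'a::euclidean_space set" and w :: "'a \<Rightarrow> real"
  assumes dom: "\<Omega> \<in> sets lborel"
    and w_meas: "set_borel_measurable lborel \<Omega> w"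
    and w_nonneg: "\<And>z. z \<in> \<Omega> \<Longrightarrow> 0 \<le> w z"
begin

lemma integrable_mult:
  assumes a: "in_L2 \<Omega> w a" and b: "in_L2 \<Omega> w b"
  shows "set_integrable lborel \<Omega> (\<lambda>z. w z * a z * b z)"
proof (rule set_integrable_bound)
  show "set_integrable lborel \<Omega> (\<lambda>z. w z * (a z)\<^sup>2 + w z * (b z)\<^sup>2)"
    using a b by (intro set_integral_add) (auto simp: in_L2_def)
  have "(\<lambda>z. (indicator \<Omega> z *\<^sub>R w z) * (indicator \<Omega> z *\<^sub>R a z) * (indicator \<Omega> z *\<^sub>R b z))
      \<in> borel_measurable lborel"
    using a b w_meas unfolding in_L2_def set_borel_measurable_def
    by (intro borel_measurable_times) auto
  also have "(\<lambda>z. (indicator \<Omega> z *\<^sub>R w z) * (indicator \<Omega> z *\<^sub>R a z) * (indicator \<Omega> z *\<^sub>R b z))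
      = (\<lambda>z. indicator \<Omega> z *\<^sub>R (w z * a z * b z))"
    by (auto simp: fun_eq_iff indicator_def)
  finally show "set_borel_measurable lborel \<Omega> (\<lambda>z. w z * a z * b z)"
    by (simp add: set_borel_measurable_def)
  have "norm (w z * a z * b z) \<le> norm (w z * (a z)\<^sup>2 + w z * (b z)\<^sup>2)" if "z \<in> \<Omega>" for z
  proof -
    have "\<bar>a z * b z\<bar> \<le> (a z)\<^sup>2 + (b z)\<^sup>2"
    proof -
      have "0 \<le> (\<bar>a z\<bar> - \<bar>b z\<bar>)\<^sup>2" by simp
      then have "2 * (\<bar>a z\<bar> * \<bar>b z\<bar>) \<le> (a z)\<^sup>2 + (b z)\<^sup>2"
        by (simp add: power2_diff)
      moreover have "0 \<le> \<bar>a z\<bar> * \<bar>b z\<bar>" by simp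
      ultimately show ?thesis unfolding abs_mult by linarith
    qed
    then have "w z * \<bar>a z * b z\<bar> \<le> w z * ((a z)\<^sup>2 + (b z)\<^sup>2)"
      using w_nonneg[OF that] by (rule mult_left_mono)
    moreover have "0 \<le> w z * ((a z)\<^sup>2 + (b z)\<^sup>2)"
      using w_nonneg[OF that] by simp
    ultimately show ?thesis
      using w_nonneg[OF that] by (simp add: abs_mult distrib_left mult.assoc)
  qed
  then show "AE z in lborel. z \<in> \<Omega> \<longrightarrow>
      norm (w z * a z * b z) \<le> norm (w z * (a z)\<^sup>2 + w z * (b z)\<^sup>2)"
    by simp
qed

end

lemma set_integrable_sum:
  fixes g :: "'i \<Rightarrow> 'a \<Rightarrow> 'b::{banach, second_countable_topology}"
  assumes "\<And>i. i \<in> I \<Longrightarrow> set_integrable M A (g i)"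
  shows "set_integrable M A (\<lambda>x. \<Sum>i\<in>I. g i x)"
  using assms unfolding set_integrable_def by (simp add: scaleR_sum_right)

lemma set_integral_sum:
  fixes g :: "'i \<Rightarrow> 'a \<Rightarrow> 'b::{banach, second_countable_topology}"
  assumes "\<And>i. i \<in> I \<Longrightarrow> set_integrable M A (g i)"
  shows "(LINT x:A|M. \<Sum>i\<in>I. g i x) = (\<Sum>i\<in>I. LINT x:A|M. g i x)"
  using assms unfolding set_integrable_def set_lebesgue_integral_def
  by (simp add: scaleR_sum_right)

lemma set_integral_lincomb:
  fixes g :: "'i \<Rightarrow> 'a \<Rightarrow> real"
  assumes "A \<in> sets M" "\<And>x. x \<in> A \<Longrightarrow> h x = (\<Sum>i\<in>I. c i * g i x)"
    and "\<And>i. i \<in> I \<Longrightarrow> set_integrable M A (g i)"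
  shows "set_integrable M A h" "(LINT x:A|M. h x) = (\<Sum>i\<in>I. c i * (LINT x:A|M. g i x))"
proof -
  have int: "set_integrable M A (\<lambda>x. c i * g i x)" if "i \<in> I" for i
    using assms(3)[OF that] by simp
  have "set_integrable M A (\<lambda>x. \<Sum>i\<in>I. c i * g i x)"
    by (intro set_integrable_sum int)
  moreover have "set_integrable M A h = set_integrable M A (\<lambda>x. \<Sum>i\<in>I. c i * g i x)"
    by (intro set_integrable_cong refl assms(2))
  ultimately show "set_integrable M A h" by simp
  have "(LINT x:A|M. h x) = (LINT x:A|M. \<Sum>i\<in>I. c i * g i x)"
    using assms(1,2) by (intro set_lebesgue_integral_cong) auto
  then show "(LINT x:A|M. h x) = (\<Sum>i\<in>I. c i * (LINT x:A|M. g i x))"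
    by (simp add: set_integral_sum int)
qed

lemma inner_L2_cong:
  assumes "\<Omega> \<in> sets lborel" "\<And>z. z \<in> \<Omega> \<Longrightarrow> w z * a z * b z = w z * a' z * b' z"
  shows "inner_L2 \<Omega> w a b = inner_L2 \<Omega> w a' b'"
  unfolding inner_L2_def using assms by (intro set_lebesgue_integral_cong) auto

text \<open>An element of the span of an orthonormal family is its own projection. The span identifies
  functions on \<open>D\<close>, so the expansion holds at every point of \<open>D\<close>, not merely almost everywhere
  on \<open>\<Omega>\<close>.\<close>

lemma (in weighted_L2) orthonormal_expansion:
  assumes F: "orthonormal_family \<Omega> w I F" and fin: "finite I"
    and h: "h \<in> fun_span D (F ` I)" and sub: "\<Omega> \<subseteq> D" and z: "z \<in> D"
  shows "h z = (\<Sum>k\<in>I. inner_L2 \<Omega> w (F k) h * F k z)"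
proof -
  have L2: "in_L2 \<Omega> w (F i)" if "i \<in> I" for i
    using F that by (auto simp: orthonormal_family_def)
  have on: "inner_L2 \<Omega> w (F i) (F j) = (if i = j then 1 else 0)" if "i \<in> I" "j \<in> I" for i j
    using F that by (auto simp: orthonormal_family_def)
  have inj: "inj_on F I"
  proof (rule inj_onI, rule ccontr)
    fix i j assume "i \<in> I" "j \<in> I" "F i = F j" "i \<noteq> j"
    then show False using on[of i i] on[of i j] by simp
  qed
  obtain T c where T: "finite T" "T \<subseteq> F ` I"
    and hT: "\<And>y. y \<in> D \<Longrightarrow> h y = (\<Sum>g\<in>T. c g * g y)"
    using h unfolding fun_span_def by blast
  define c' where "c' k = (if F k \<in> T then c (F k) else 0)" for k
  have h': "h y = (\<Sum>k\<in>I. c' k * F k y)" if "y \<in> D" for y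
  proof -
    have "(\<Sum>g\<in>T. c g * g y) = (\<Sum>g\<in>F ` I. (if g \<in> T then c g else 0) * g y)"
      using T fin by (intro sum.mono_neutral_cong_left) auto
    also have "\<dots> = (\<Sum>k\<in>I. c' k * F k y)"
      unfolding c'_def by (subst sum.reindex[OF inj]) simp
    finally show ?thesis using hT[OF that] by simp
  qed
  have coef: "inner_L2 \<Omega> w (F k) h = c' k" if k: "k \<in> I" for k
  proof -
    have "(LINT z:\<Omega>|lborel. w z * F k z * h z)
        = (\<Sum>i\<in>I. c' i * (LINT z:\<Omega>|lborel. w z * F k z * F i z))"
    proof (rule set_integral_lincomb[OF dom])
      fix x assume "x \<in> \<Omega>"
      then have "h x = (\<Sum>k\<in>I. c' k * F k x)" using h' sub by auto
      then show "w x * F k x * h x = (\<Sum>i\<in>I. c' i * (w x * F k x * F i x))"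
        by (simp add: sum_distrib_left algebra_simps)
    next
      fix i assume "i \<in> I"
      then show "set_integrable lborel \<Omega> (\<lambda>z. w z * F k z * F i z)"
        by (intro integrable_mult L2 k)
    qed
    also have "\<dots> = (\<Sum>i\<in>I. c' i * (if k = i then 1 else 0))"
      using on k unfolding inner_L2_def by (intro sum.cong) auto
    also have "\<dots> = (\<Sum>i\<in>I. if k = i then c' i else 0)"
      by (intro sum.cong) auto
    also have "\<dots> = c' k" using fin k by simp
    finally show ?thesis by (simp add: inner_L2_def)
  qed
  show ?thesis using h'[OF z] coef by simp
qed

lemma fun_span_superset: "g \<in> G \<Longrightarrow> g \<in> fun_span D G"
  unfolding fun_span_def by (intro CollectI exI[of _ "{g}"] exI[of _ "\<lambda>_. 1"]) simp

lemma set_integral_prod_mult: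
  fixes a :: "'a::euclidean_space \<Rightarrow> real" and b :: "'b::euclidean_space \<Rightarrow> real"
  assumes a: "set_integrable lborel A a" and b: "set_integrable lborel B b"
  shows "set_integrable lborel (A \<times> B) (\<lambda>z. a (fst z) * b (snd z))"
    and "(LINT z:A \<times> B|lborel. a (fst z) * b (snd z)) =
           (LINT x:A|lborel. a x) * (LINT y:B|lborel. b y)"
proof -
  let ?a = "\<lambda>x. indicator A x * a x" and ?b = "\<lambda>y. indicator B y * b y"
  have a': "integrable lborel ?a" and b': "integrable lborel ?b"
    using a b by (auto simp: set_integrable_def)
  have int: "integrable (lborel \<Otimes>\<^sub>M lborel) (\<lambda>(x, y). ?a x * ?b y)"
  proof (rule lborel_pair.Fubini_integrable)
    have [measurable]: "?a \<in> borel_measurable lborel" "?b \<in> borel_measurable lborel"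
      using a' b' by auto
    show "(\<lambda>(x, y). ?a x * ?b y) \<in> borel_measurable (lborel \<Otimes>\<^sub>M lborel)"
      by measurable
    have "(\<lambda>x. LINT y|lborel. norm (case (x, y) of (x, y) \<Rightarrow> ?a x * ?b y))
        = (\<lambda>x. \<bar>?a x\<bar> * (LINT y|lborel. \<bar>?b y\<bar>))"
      by (auto simp: fun_eq_iff abs_mult)
    then show "integrable lborel (\<lambda>x. LINT y|lborel. norm (case (x, y) of (x, y) \<Rightarrow> ?a x * ?b y))"
      using a' by (simp only:) (intro integrable_mult_left integrable_abs)
    show "AE x in lborel. integrable lborel (\<lambda>y. case (x, y) of (x, y) \<Rightarrow> ?a x * ?b y)"
      using b' by simp
  qed
  have eq: "(\<lambda>z. indicator (A \<times> B) z *\<^sub>R (a (fst z) * b (snd z))) = (\<lambda>(x, y). ?a x * ?b y)"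
    by (auto simp: fun_eq_iff indicator_def)
  show "set_integrable lborel (A \<times> B) (\<lambda>z. a (fst z) * b (snd z))"
    unfolding set_integrable_def eq using int by (simp add: lborel_prod)
  have "(LINT z|lborel. (case z of (x, y) \<Rightarrow> ?a x * ?b y))
      = (LINT x|lborel. LINT y|lborel. ?a x * ?b y)"
    using lborel_pair.integral_fst'[OF int] by (simp add: lborel_prod)
  also have "\<dots> = (LINT x|lborel. ?a x) * (LINT y|lborel. ?b y)"
    by simp
  finally show "(LINT z:A \<times> B|lborel. a (fst z) * b (snd z)) =
           (LINT x:A|lborel. a x) * (LINT y:B|lborel. b y)"
    unfolding set_lebesgue_integral_def eq by simp
qed

lemma set_integral_scaleR_vec_nth:
  fixes g :: "real^'d::finite \<Rightarrow> real"
  assumes "\<And>s. set_integrable lborel \<Omega> (\<lambda>v. g v * v $ s)"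
  shows "(LINT v:\<Omega>|lborel. g v *\<^sub>R v) $ s = (LINT v:\<Omega>|lborel. g v * v $ s)"
proof -
  have "(\<lambda>v. indicator \<Omega> v *\<^sub>R (g v *\<^sub>R v))
      = (\<lambda>v. \<Sum>s\<in>UNIV. (indicator \<Omega> v *\<^sub>R (g v * v $ s)) *\<^sub>R axis s 1)"
    by (auto simp: fun_eq_iff vec_eq_iff axis_def sum.delta' if_distrib[where f="\<lambda>x. _ * x"]
          cong: if_cong)
  moreover have "integrable lborel \<dots>"
    using assms unfolding set_integrable_def
    by (intro Bochner_Integration.integrable_sum integrable_scaleR_left) auto
  ultimately have int: "integrable lborel (\<lambda>v. indicator \<Omega> v *\<^sub>R (g v *\<^sub>R v))"
    by (simp only:)
  have "(LINT v|lborel. indicator \<Omega> v *\<^sub>R (g v *\<^sub>R v)) \<bullet> axis s 1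
      = (LINT v|lborel. (indicator \<Omega> v *\<^sub>R (g v *\<^sub>R v)) \<bullet> axis s 1)"
    using int by (intro integral_inner_left[symmetric])
  then show ?thesis
    unfolding set_lebesgue_integral_def by (simp add: inner_axis mult.assoc)
qed

lemma inner_L2_commute: "inner_L2 \<Omega> w a b = inner_L2 \<Omega> w b a"
  by (simp add: inner_L2_def mult.commute mult.left_commute)

lemma in_L2_continuous:
  assumes "continuous_on (cbox lo hi) h"
  shows "in_L2 (cbox lo hi) (\<lambda>x. 1) h"
proof -
  have "set_borel_measurable borel (cbox lo hi) h"
    using assms by (intro set_measurable_continuous_on) auto
  moreover have "set_integrable lborel (cbox lo hi) (\<lambda>x. (h x)\<^sup>2)"
    unfolding set_integrable_def using assms
    by (intro borel_integrable_compact) (auto intro!: continuous_intros)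
  ultimately show ?thesis
    by (simp add: in_L2_def set_borel_measurable_def)
qed

section \<open>Periodic functions\<close>

lemma grad_nth [simp]: "grad f x $ s = partial s f x"
  by (simp add: grad_def)

lemma partial_eqI: "(f has_derivative f') (at x) \<Longrightarrow> partial s f x = f' (axis s 1)"
  unfolding partial_def using frechet_derivative_at by metis

lemma C1_on_continuous: "open S \<Longrightarrow> C1_on S f \<Longrightarrow> continuous_on S f"
  by (auto simp: C1_on_def continuous_on_eq_continuous_at differentiable_imp_continuous_within)

lemma C1_on_continuous_partial:
  assumes "C1_on S f"
  shows "continuous_on S (partial s f)"
  using continuous_on_component[of S "grad f" s] assms by (simp add: C1_on_def)

lemma partial_has_field_derivative:
  assumes "f differentiable (at (x + t *\<^sub>R axis s 1))"
  shows "((\<lambda>t. f (x + t *\<^sub>R axis s 1)) has_field_derivative partial s f (x + t *\<^sub>R axis s 1))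
           (at t within T)"
proof -
  let ?f' = "frechet_derivative f (at (x + t *\<^sub>R axis s 1))"
  have "(f has_derivative ?f') (at (x + t *\<^sub>R axis s 1))"
    using assms by (simp add: frechet_derivative_works)
  moreover have "((\<lambda>t. x + t *\<^sub>R axis s 1) has_derivative (\<lambda>h. h *\<^sub>R axis s 1)) (at t within T)"
    by (auto intro!: derivative_eq_intros)
  ultimately have "((\<lambda>t. f (x + t *\<^sub>R axis s 1)) has_derivative (\<lambda>h. ?f' (h *\<^sub>R axis s 1)))
      (at t within T)"
    using has_derivative_compose[of "\<lambda>t. x + t *\<^sub>R axis s 1" _ t T f ?f'] by simp
  moreover have "linear ?f'"
    using assms by (rule linear_frechet_derivative)
  then have "(\<lambda>h. ?f' (h *\<^sub>R axis s 1)) = (*) (partial s f (x + t *\<^sub>R axis s 1))"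
    by (auto simp: fun_eq_iff partial_def linear_cmul mult.commute)
  ultimately show ?thesis
    by (simp add: has_field_derivative_def)
qed

lemma box_periodic_partial:
  assumes "box_periodic lo hi f" and "\<And>x. f differentiable (at x)"
  shows "box_periodic lo hi (partial s f)"
  unfolding box_periodic_def
proof (intro allI)
  fix x s'
  let ?p = "(hi $ s' - lo $ s') *\<^sub>R axis s' 1 :: real^'a"
  have "(f has_derivative frechet_derivative f (at (x + ?p))) (at (x + ?p))"
    using assms(2) by (simp add: frechet_derivative_works[symmetric])
  moreover have "((\<lambda>y. y + ?p) has_derivative (\<lambda>h. h)) (at x)"
    by (auto intro!: derivative_eq_intros)
  ultimately have "((\<lambda>y. f (y + ?p)) has_derivative frechet_derivative f (at (x + ?p))) (at x)"
    using has_derivative_compose[of "\<lambda>y. y + ?p" "\<lambda>h. h" x UNIV f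
        "frechet_derivative f (at (x + ?p))"] by simp
  moreover have "(\<lambda>y. f (y + ?p)) = f"
    using assms(1) by (auto simp: box_periodic_def)
  ultimately show "partial s f (x + ?p) = partial s f x"
    using partial_eqI[of f _ x s] by (simp add: partial_def)
qed

lemma box_periodic_shift_int:
  assumes "box_periodic lo hi f"
  shows "f (x + (of_int k * (hi $ s - lo $ s)) *\<^sub>R axis s 1) = f x"
proof -
  have nat: "f (x + (real n * (hi $ s - lo $ s)) *\<^sub>R axis s 1) = f x" for n :: nat and x
  proof (induction n)
    case (Suc n)
    have "x + (real (Suc n) * (hi $ s - lo $ s)) *\<^sub>R axis s 1
        = (x + (real n * (hi $ s - lo $ s)) *\<^sub>R axis s 1) + (hi $ s - lo $ s) *\<^sub>R axis s 1"
      by (simp add: algebra_simps)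
    then show ?case using assms Suc unfolding box_periodic_def by metis
  qed simp
  show ?thesis
  proof (cases "0 \<le> k")
    case True
    then show ?thesis using nat[of x "nat k"] by simp
  next
    case False
    then have "real (nat (- k)) = - of_int k" by simp
    then show ?thesis
      using nat[of "x + (of_int k * (hi $ s - lo $ s)) *\<^sub>R axis s 1" "nat (- k)"]
      by (simp add: algebra_simps)
  qed
qed

text \<open>The same point \<open>y\<close> serves for all periodic functions.\<close>

lemma box_periodic_reduce:
  fixes lo hi x :: "real^'d::finite"
  assumes box: "\<And>s. lo $ s < hi $ s"
  shows "\<exists>y\<in>cbox lo hi. \<forall>f. box_periodic lo hi f \<longrightarrow> f y = f x"
proof -
  have "\<exists>y. (\<forall>s\<in>T. lo $ s \<le> y $ s \<and> y $ s \<le> hi $ s) \<and>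
          (\<forall>f. box_periodic lo hi f \<longrightarrow> f y = f x)" if "finite T" for T :: "'d set"
    using that
  proof (induction T)
    case (insert s T)
    then obtain y where y: "\<And>s. s \<in> T \<Longrightarrow> lo $ s \<le> y $ s \<and> y $ s \<le> hi $ s"
      "\<And>f. box_periodic lo hi f \<Longrightarrow> f y = f x" by blast
    define L where "L = hi $ s - lo $ s"
    define k where "k = \<lfloor>(y $ s - lo $ s) / L\<rfloor>"
    define y' where "y' = y + (of_int (- k) * L) *\<^sub>R axis s 1"
    have L: "L > 0" using box[of s] by (simp add: L_def)
    have "of_int k \<le> (y $ s - lo $ s) / L" "(y $ s - lo $ s) / L \<le> of_int k + 1"
      unfolding k_def by linarith+
    then have "of_int k * L \<le> y $ s - lo $ s" "y $ s - lo $ s \<le> (of_int k + 1) * L"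
      using L by (simp_all add: field_simps)
    then have "lo $ s \<le> y' $ s \<and> y' $ s \<le> hi $ s"
      by (simp add: y'_def axis_def algebra_simps) (simp add: L_def)
    moreover have "y' $ s' = y $ s'" if "s' \<in> T" for s'
      using that insert by (auto simp: y'_def axis_def)
    ultimately have "\<forall>s'\<in>insert s T. lo $ s' \<le> y' $ s' \<and> y' $ s' \<le> hi $ s'"
      using y(1) by auto
    moreover have "f y' = f x" if "box_periodic lo hi f" for f
      using box_periodic_shift_int[OF that, of y "- k" s] y(2)[OF that]
      by (simp add: y'_def L_def)
    ultimately show ?case by blast
  qed auto
  from this[of UNIV] obtain y where "\<forall>s\<in>UNIV. lo $ s \<le> y $ s \<and> y $ s \<le> hi $ s"
    "\<And>f. box_periodic lo hi f \<Longrightarrow> f y = f x" by auto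
  then show ?thesis by (intro bexI[of _ y]) (auto simp: mem_box_cart)
qed

lemma box_periodic_bounded:
  fixes lo hi :: "real^'d::finite"
  assumes "\<And>s. lo $ s < hi $ s" "box_periodic lo hi f" "continuous_on UNIV f"
  obtains B where "\<And>x. \<bar>f x\<bar> \<le> B"
proof -
  have "compact (f ` cbox lo hi)"
    using assms(3) by (intro compact_continuous_image) (auto intro: continuous_on_subset)
  then have "bounded (f ` cbox lo hi)" by (rule compact_imp_bounded)
  then obtain B where B: "\<And>y. y \<in> cbox lo hi \<Longrightarrow> \<bar>f y\<bar> \<le> B"
    unfolding bounded_iff by auto
  have "\<bar>f x\<bar> \<le> B" for x
    using box_periodic_reduce[OF assms(1), of x] B assms(2) by metis
  then show ?thesis by (rule that)
qed

text \<open>The two slabs by which the box and its translate differ are translates of each other by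
  the period.\<close>

lemma integral_box_translate:
  fixes lo hi :: "real^'d::finite" and g :: "real^'d \<Rightarrow> real"
  assumes box: "\<And>s. lo $ s < hi $ s" and per: "box_periodic lo hi g"
    and cont: "continuous_on UNIV g" and t: "0 \<le> t" "t \<le> hi $ s - lo $ s"
  shows "integral (cbox lo hi) (\<lambda>x. g (x + t *\<^sub>R axis s 1)) = integral (cbox lo hi) g"
proof -
  define e where "e = (axis s 1 :: real^'d)"
  define L where "L = hi $ s - lo $ s"
  have e: "e \<in> Basis" unfolding e_def by simp
  have en: "x \<bullet> e = x $ s" for x unfolding e_def by (simp add: inner_axis)
  have e_nth: "e $ i = (if i = s then 1 else 0)" for i unfolding e_def axis_def by auto
  have int: "g integrable_on cbox a b" for a b
    using cont by (intro integrable_continuous) (auto intro: continuous_on_subset)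
  \<comment> \<open>The hull of the box and its translate is cut in two ways: at the upper face of the box, and
    at the lower face of the translate.\<close>
  have split: "integral (cbox a b) g = integral (cbox a b \<inter> {x. x $ s \<le> c}) g
      + integral (cbox a b \<inter> {x. x $ s \<ge> c}) g" for a b c
    using integral_split[OF int e, of a b c] by (simp add: en)
  define lo' where "lo' = (\<chi> i. if i = s then hi $ s else lo $ i)"
  define hi' where "hi' = (\<chi> i. if i = s then lo $ s + t else hi $ i)"
  have sum1: "cbox lo (hi + t *\<^sub>R e) \<inter> {x. x $ s \<le> hi $ s} = cbox lo hi"
    using t by (auto simp: mem_box_cart e_nth split: if_splits)
      (smt (verit) mult.right_neutral)+
  have sum2: "cbox lo (hi + t *\<^sub>R e) \<inter> {x. x $ s \<ge> hi $ s} = cbox lo' (hi + t *\<^sub>R e)"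
  proof (intro set_eqI iffI)
    fix x assume "x \<in> cbox lo (hi + t *\<^sub>R e) \<inter> {x. x $ s \<ge> hi $ s}"
    then show "x \<in> cbox lo' (hi + t *\<^sub>R e)" by (auto simp: mem_box_cart lo'_def)
  next
    fix x assume "x \<in> cbox lo' (hi + t *\<^sub>R e)"
    then have x: "lo' $ i \<le> x $ i" "x $ i \<le> (hi + t *\<^sub>R e) $ i" for i
      by (auto simp: mem_box_cart)
    have "lo $ i \<le> x $ i" for i
      using x(1)[of i] box[of s] by (auto simp: lo'_def split: if_splits)
    then show "x \<in> cbox lo (hi + t *\<^sub>R e) \<inter> {x. x $ s \<ge> hi $ s}"
      using x x(1)[of s] by (auto simp: mem_box_cart lo'_def)
  qed
  have sum3: "cbox lo (hi + t *\<^sub>R e) \<inter> {x. x $ s \<le> lo $ s + t} = cbox lo hi'"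
    using t by (force simp: mem_box_cart e_nth hi'_def split: if_splits)
  have sum4: "cbox lo (hi + t *\<^sub>R e) \<inter> {x. x $ s \<ge> lo $ s + t}
      = cbox (lo + t *\<^sub>R e) (hi + t *\<^sub>R e)"
    using t by (force simp: mem_box_cart e_nth split: if_splits)
  have ends: "lo + L *\<^sub>R e = lo'" "hi' + L *\<^sub>R e = hi + t *\<^sub>R e"
    by (auto simp: vec_eq_iff e_nth lo'_def hi'_def L_def)
  have "g (L *\<^sub>R e + x) = g x" for x
    using per by (simp add: box_periodic_def L_def e_def add.commute)
  then have "integral (cbox lo hi') g = integral (cbox lo' (hi + t *\<^sub>R e)) g"
    using integral_shift_cbox_plus[of lo hi' g "L *\<^sub>R e"] ends by (simp add: o_def)
  moreover have "integral (cbox lo hi) (\<lambda>x. g (x + t *\<^sub>R e))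
      = integral (cbox (lo + t *\<^sub>R e) (hi + t *\<^sub>R e)) g"
    using integral_shift_cbox_plus[of lo hi g "t *\<^sub>R e"] by (simp add: o_def add.commute)
  ultimately show ?thesis
    using split[of lo "hi + t *\<^sub>R e" "hi $ s"] split[of lo "hi + t *\<^sub>R e" "lo $ s + t"]
    unfolding sum1 sum2 sum3 sum4 e_def[symmetric] by simp
qed

text \<open>The derivative at \<open>0\<close> of the constant function \<open>t \<mapsto> \<integral> g (x + t e\<^sub>s) dx\<close>.\<close>

lemma integral_partial_periodic:
  fixes lo hi :: "real^'d::finite" and g :: "real^'d \<Rightarrow> real"
  assumes box: "\<And>s. lo $ s < hi $ s" and per: "box_periodic lo hi g" and C1: "C1_on UNIV g"
  shows "integral (cbox lo hi) (partial s g) = 0"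
proof -
  let ?e = "axis s 1 :: real^'d"
  let ?T = "{0..hi $ s - lo $ s}"
  let ?I = "\<lambda>t. integral (cbox lo hi) (\<lambda>x. g (x + t *\<^sub>R ?e))"
  have cont: "continuous_on UNIV g" and cont': "continuous_on UNIV (partial s g)"
    using C1 by (auto intro: C1_on_continuous C1_on_continuous_partial)
  have diff: "g differentiable (at x)" for x using C1 by (simp add: C1_on_def)
  have "(?I has_field_derivative integral (cbox lo hi) (\<lambda>x. partial s g (x + 0 *\<^sub>R ?e)))
      (at 0 within ?T)"
  proof (rule leibniz_rule_field_derivative[where fx = "\<lambda>t x. partial s g (x + t *\<^sub>R ?e)"])
    fix t :: real and x :: "real^'d"
    show "((\<lambda>t. g (x + t *\<^sub>R ?e)) has_field_derivative partial s g (x + t *\<^sub>R ?e))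
        (at t within ?T)"
      by (rule partial_has_field_derivative[OF diff])
  next
    fix t :: real
    show "(\<lambda>x. g (x + t *\<^sub>R ?e)) integrable_on cbox lo hi"
      by (intro integrable_continuous continuous_on_compose2[OF cont] continuous_intros) auto
  next
    have "continuous_on (?T \<times> cbox lo hi) (\<lambda>p. partial s g (snd p + fst p *\<^sub>R ?e))"
      by (intro continuous_on_compose2[OF cont'] continuous_intros) auto
    then show "continuous_on (?T \<times> cbox lo hi) (\<lambda>(t, x). partial s g (x + t *\<^sub>R ?e))"
      by (simp add: case_prod_unfold)
  qed (use box[of s] in auto)
  then have D: "(?I has_real_derivative integral (cbox lo hi) (partial s g)) (at 0 within ?T)"
    by simp
  have "?I t = integral (cbox lo hi) g" if "t \<in> ?T" for t
    using that integral_box_translate[OF box per cont, of t s] by simp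
  then have "(?I has_real_derivative 0) (at 0 within ?T)"
    using has_field_derivative_transform_within[OF DERIV_const, of 1 0 ?T _ ?I] box[of s]
    by (simp add: less_imp_le)
  with D show ?thesis
    using vector_derivative_unique_within_closed_interval[of 0 "hi $ s - lo $ s" 0 ?I] box[of s]
    by (simp add: has_real_derivative_iff_has_vector_derivative)
qed

text \<open>Energy argument: the integral over a period of the divergence of \<open>u \<nabla>u\<close>, which equals
  \<open>\<bar>\<nabla>u\<bar>\<^sup>2\<close> for harmonic \<open>u\<close>, vanishes.\<close>

theorem periodic_harmonic_partial_zero:
  fixes lo hi :: "real^'d::finite" and u :: "real^'d \<Rightarrow> real"
  assumes box: "\<And>s. lo $ s < hi $ s" and per: "box_periodic lo hi u" and C2: "C2_on UNIV u"
    and harm: "\<And>x. divergence (grad u) x = 0"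
  shows "partial s u x = 0"
proof -
  have du: "u differentiable (at x)" for x using C2 by (simp add: C2_on_def C1_on_def)
  have dpu: "partial s u differentiable (at x)" for s x
    using C2 by (simp add: C2_on_def C1_on_def)
  have cont: "continuous_on UNIV u" "continuous_on UNIV (partial s u)"
    "continuous_on UNIV (partial s' (partial s u))" for s s'
    using C2 by (auto simp: C2_on_def intro: C1_on_continuous C1_on_continuous_partial)
  have D: "((\<lambda>y. u y * partial s u y) has_derivative
      (\<lambda>h. u x * frechet_derivative (partial s u) (at x) h
         + frechet_derivative u (at x) h * partial s u x)) (at x)" for s x
    using du dpu by (intro has_derivative_mult) (simp_all add: frechet_derivative_works[symmetric])
  have P: "partial s' (\<lambda>y. u y * partial s u y) x
      = u x * partial s' (partial s u) x + partial s' u x * partial s u x" for s s' x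
    using partial_eqI[OF D] by (simp add: partial_def)
  have C1: "C1_on UNIV (\<lambda>y. u y * partial s u y)" for s
  proof -
    have "continuous_on UNIV (\<lambda>x. \<chi> s'. partial s' (\<lambda>y. u y * partial s u y) x)"
      unfolding P by (intro continuous_intros cont)
    then show ?thesis
      using D by (auto simp: C1_on_def grad_def[abs_def] differentiable_def)
  qed
  have per': "box_periodic lo hi (\<lambda>y. u y * partial s u y)" for s
    using per box_periodic_partial[OF per du, of s] by (simp add: box_periodic_def)
  define q where "q x = (\<Sum>s\<in>UNIV. (partial s u x)\<^sup>2)" for x
  have cq: "continuous_on UNIV q"
    unfolding q_def by (intro continuous_intros cont)
  have "q x = (\<Sum>s\<in>UNIV. partial s (\<lambda>y. u y * partial s u y) x)" for x
    using harm[of x]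
    by (simp add: P q_def sum.distrib power2_eq_square divergence_def flip: sum_distrib_left)
  then have "integral (cbox lo hi) q
      = integral (cbox lo hi) (\<lambda>x. \<Sum>s\<in>UNIV. partial s (\<lambda>y. u y * partial s u y) x)"
    by (intro arg_cong[where f = "integral (cbox lo hi)"] ext)
  also have "\<dots> = (\<Sum>s\<in>UNIV. integral (cbox lo hi) (partial s (\<lambda>y. u y * partial s u y)))"
    by (intro integral_sum integrable_continuous)
       (auto intro: continuous_on_subset[OF C1_on_continuous_partial[OF C1]])
  also have "\<dots> = 0"
    using integral_partial_periodic[OF box per' C1] by simp
  finally have "integral (cbox lo hi) q = 0" .
  moreover have "box lo hi \<noteq> {}"
    using box by (simp add: interval_ne_empty_cart)
  moreover have nonneg: "0 \<le> q x" for x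
    by (simp add: q_def sum_nonneg)
  ultimately have q0: "q y = 0" if "y \<in> cbox lo hi" for y
    using that integral_cbox_eq_0_iff[of lo hi q] continuous_on_subset[OF cq] by auto
  obtain y where y: "y \<in> cbox lo hi" "\<And>f. box_periodic lo hi f \<Longrightarrow> f y = f x"
    using box_periodic_reduce[OF box] by metis
  have "partial s u y = 0"
    using q0[OF y(1)] by (simp add: q_def sum_nonneg_eq_0_iff)
  then show ?thesis
    using y(2)[OF box_periodic_partial[OF per du]] by metis
qed

section \<open>The right-hand side depends only on the values over the velocity domain\<close>

lemma partial_cong_open:
  assumes "open T" "x \<in> T" "\<And>y. y \<in> T \<Longrightarrow> f y = g y"
  shows "partial s f x = partial s g x"
proof -
  have "(f has_derivative f') (at x) \<longleftrightarrow> (g has_derivative f') (at x)" for f'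
    using assms has_derivative_transform_within_open[of _ f' x UNIV T] by metis
  then show ?thesis by (simp add: partial_def frechet_derivative_def)
qed

lemma poisson_solvable_efield:
  assumes "poisson_solvable lo hi \<Omega>v f"
  shows "is_efield lo hi \<Omega>v f (efield lo hi \<Omega>v f)"
  using assms unfolding poisson_solvable_def efield_def by (rule someI_ex)

lemma efield_cong:
  assumes "\<Omega>v \<in> sets lborel" "\<And>x v. v \<in> \<Omega>v \<Longrightarrow> f x v = g x v"
  shows "efield lo hi \<Omega>v f = efield lo hi \<Omega>v g"
proof -
  have "(LINT v:\<Omega>v|lborel. f x v) = (LINT v:\<Omega>v|lborel. g x v)" for x
    using assms by (intro set_lebesgue_integral_cong) auto
  then show ?thesis by (simp add: efield_def is_efield_def)
qed

lemma vp_rhs_cong: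
  assumes "open \<Omega>v" "\<And>x v. v \<in> \<Omega>v \<Longrightarrow> f x v = g x v" "v \<in> \<Omega>v"
  shows "vp_rhs lo hi \<Omega>v f x v = vp_rhs lo hi \<Omega>v g x v"
proof -
  have "partial s (f x) v = partial s (g x) v" for s
    using assms by (intro partial_cong_open[of \<Omega>v])
  moreover have "(\<lambda>y. f y v) = (\<lambda>y. g y v)" using assms by auto
  moreover have "efield lo hi \<Omega>v f = efield lo hi \<Omega>v g"
    using assms by (intro efield_cong) auto
  ultimately show ?thesis by (simp add: vp_rhs_def grad_def)
qed

lemma sum_swap_pairs:
  "(\<Sum>k\<in>A. \<Sum>l\<in>B. \<Sum>i\<in>C. \<Sum>j\<in>D. t k l i j) = (\<Sum>i\<in>C. \<Sum>j\<in>D. \<Sum>k\<in>A. \<Sum>l\<in>B. t k l i j)"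
proof -
  have "(\<Sum>z\<in>A \<times> B. \<Sum>w\<in>C \<times> D. t (fst z) (snd z) (fst w) (snd w))
      = (\<Sum>w\<in>C \<times> D. \<Sum>z\<in>A \<times> B. t (fst z) (snd z) (fst w) (snd w))"
    by (rule sum.swap)
  then show ?thesis by (simp add: sum.cartesian_product')
qed

section \<open>Velocity moments of a low-rank state\<close>

text \<open>The state at the beginning of a step. Only the smoothness and decay that the moments
  require are assumed; the fixed functions \<open>U\<close> are any
  orthonormal ones.\<close>

locale low_rank_state =
  fixes lo hi :: "real^'d::finite"
    and \<Omega>v :: "(real^'d) set"
    and f0v :: "real^'d \<Rightarrow> real"
    and m r :: nat
    and X U W V :: "nat \<Rightarrow> real^'d \<Rightarrow> real"
    and S :: "nat \<Rightarrow> nat \<Rightarrow> real"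
    and f :: "real^'d \<Rightarrow> real^'d \<Rightarrow> real"
  assumes open_v: "open \<Omega>v"
    and f0v_pos: "\<And>v. v \<in> \<Omega>v \<Longrightarrow> f0v v > 0"
    and f0v_smooth: "C1_on \<Omega>v f0v"
    and m_le: "m \<le> r"
    and V: "V = join_at m U W"
    and f: "f = low_rank f0v r r X S V"
    and V_orth: "orthonormal_family \<Omega>v f0v {1..r} V"
    and X_smooth: "\<And>i. i \<in> {1..r} \<Longrightarrow> C1_on UNIV (X i)"
    and V_smooth: "\<And>j. j \<in> {1..r} \<Longrightarrow> C1_on \<Omega>v (V j)"
    and V_decay: "\<And>j s. j \<in> {1..r} \<Longrightarrow> in_L2 \<Omega>v f0v (\<lambda>v. v $ s * V j v)"
      "\<And>j s. j \<in> {1..r} \<Longrightarrow>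
         in_L2 \<Omega>v f0v (\<lambda>v. partial s (\<lambda>w. f0v w * V j w) v / f0v v)"
    and field: "poisson_solvable lo hi \<Omega>v f"
begin

sublocale vel: weighted_L2 \<Omega>v f0v
proof
  show "\<Omega>v \<in> sets lborel" using open_v by simp
  show "set_borel_measurable lborel \<Omega>v f0v"
    using set_measurable_continuous_on[of \<Omega>v f0v] C1_on_continuous[OF open_v f0v_smooth] open_v
    by (simp add: set_borel_measurable_def)
  show "0 \<le> f0v v" if "v \<in> \<Omega>v" for v using f0v_pos[OF that] by simp
qed

sublocale space: weighted_L2 "cbox lo hi" "\<lambda>x. 1"
proof
  show "set_borel_measurable lborel (cbox lo hi) (\<lambda>x. 1::real)"
    by (simp add: set_borel_measurable_def)
qed auto

abbreviation rhs where "rhs \<equiv> vp_rhs lo hi \<Omega>v f"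
abbreviation E where "E \<equiv> efield lo hi \<Omega>v f"

text \<open>The columns \<open>K\<^sub>j = \<Sum>\<^sub>i X\<^sub>i S\<^sub>i\<^sub>j\<close> of the old solution.\<close>

definition K :: "nat \<Rightarrow> real^'d \<Rightarrow> real" where
  "K j x = (\<Sum>i=1..r. X i x * S i j)"

text \<open>The moment of the right-hand side against \<open>a\<close>.\<close>

definition moment :: "(real^'d \<Rightarrow> real) \<Rightarrow> real^'d \<Rightarrow> real" where
  "moment a x = (LINT v:\<Omega>v|lborel. a v * rhs x v)"

text \<open>The right-hand side is again of finite rank,
  \<open>rhs x v = (\<Sum>n\<in>N. \<alpha> n x * \<beta> n v)\<close>: an index \<open>(s, j, b)\<close> consists of a coordinate \<open>s\<close>, a column
  \<open>j\<close> and a flag \<open>b\<close>, which is true for the transport term and false for the field term.\<close>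

definition N :: "('d \<times> nat \<times> bool) set" where
  "N = UNIV \<times> {1..r} \<times> UNIV"

definition \<alpha> :: "'d \<times> nat \<times> bool \<Rightarrow> real^'d \<Rightarrow> real" where
  "\<alpha> = (\<lambda>(s, j, b) x. if b then - partial s (K j) x else E x $ s * K j x)"

definition \<beta> :: "'d \<times> nat \<times> bool \<Rightarrow> real^'d \<Rightarrow> real" where
  "\<beta> = (\<lambda>(s, j, b) v. if b then v $ s * (f0v v * V j v) else partial s (\<lambda>w. f0v w * V j w) v)"

lemma N_cases:
  assumes "n \<in> N"
  obtains s j b where "n = (s, j, b)" "j \<in> {1..r}"
  using assms unfolding N_def by (cases n) auto

lemma sum_N: "(\<Sum>n\<in>N. t n) = (\<Sum>s\<in>UNIV. \<Sum>j=1..r. t (s, j, True) + t (s, j, False))"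
  unfolding N_def by (simp add: sum.cartesian_product' UNIV_bool add.commute)

lemma V_L2: "j \<in> {1..r} \<Longrightarrow> in_L2 \<Omega>v f0v (V j)"
  and V_inner: "i \<in> {1..r} \<Longrightarrow> j \<in> {1..r} \<Longrightarrow> inner_L2 \<Omega>v f0v (V i) (V j) = (if i = j then 1 else 0)"
  using V_orth by (auto simp: orthonormal_family_def)

lemma V_fixed: "b \<in> {1..m} \<Longrightarrow> V b = U b"
  by (simp add: V join_at_def)

lemma f_eq: "f x v = (\<Sum>j=1..r. K j x * (f0v v * V j v))"
  unfolding f low_rank_def K_def
  by (subst sum.swap) (simp add: sum_distrib_left sum_distrib_right algebra_simps)

lemma K_derivative:
  "(K j has_derivative (\<lambda>h. \<Sum>i=1..r. frechet_derivative (X i) (at x) h * S i j)) (at x)"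
proof -
  have "(X i has_derivative frechet_derivative (X i) (at x)) (at x)" if "i \<in> {1..r}" for i
    using X_smooth[OF that] by (simp add: C1_on_def frechet_derivative_works[symmetric])
  then show ?thesis
    unfolding K_def[abs_def] by (auto intro!: derivative_eq_intros)
qed

lemma K_differentiable: "K j differentiable (at x)"
  using K_derivative differentiable_def by blast

lemma K_partial: "partial s (K j) x = (\<Sum>i=1..r. partial s (X i) x * S i j)"
  using partial_eqI[OF K_derivative] by (simp add: partial_def)

lemma K_continuous: "continuous_on UNIV (K j)"
  unfolding K_def[abs_def] using X_smooth C1_on_continuous[OF open_UNIV]
  by (intro continuous_intros) auto

lemma K_partial_continuous: "continuous_on UNIV (partial s (K j))"
  unfolding K_partial[abs_def] using X_smooth C1_on_continuous_partial
  by (intro continuous_intros) auto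

lemma E_continuous: "continuous_on UNIV (\<lambda>x. E x $ s)"
proof -
  obtain \<phi> where \<phi>: "C2_on UNIV \<phi>" "\<And>x. E x = - grad \<phi> x"
    using poisson_solvable_efield[OF field] unfolding is_efield_def by blast
  have "continuous_on UNIV (partial s \<phi>)"
    using \<phi>(1) C1_on_continuous_partial unfolding C2_on_def by blast
  then show ?thesis by (simp add: \<phi>(2) continuous_on_minus)
qed

lemma \<alpha>_L2: "in_L2 (cbox lo hi) (\<lambda>x. 1) (\<alpha> n)"
proof (rule in_L2_continuous)
  have "continuous_on UNIV (\<alpha> n)"
    by (cases n; cases "snd (snd n)")
       (simp_all add: \<alpha>_def continuous_intros K_continuous K_partial_continuous E_continuous)
  then show "continuous_on (cbox lo hi) (\<alpha> n)" by (rule continuous_on_subset) simp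
qed

lemma f0v_V_derivative:
  assumes "v \<in> \<Omega>v" "j \<in> {1..r}"
  shows "((\<lambda>w. f0v w * V j w) has_derivative frechet_derivative (\<lambda>w. f0v w * V j w) (at v)) (at v)"
proof -
  have "(\<lambda>w. f0v w * V j w) differentiable (at v)"
    using f0v_smooth V_smooth[OF assms(2)] assms(1) by (simp add: C1_on_def)
  then show ?thesis by (simp add: frechet_derivative_works)
qed

lemma rhs_eq:
  assumes "v \<in> \<Omega>v"
  shows "rhs x v = (\<Sum>n\<in>N. \<alpha> n x * \<beta> n v)"
proof -
  have x_part: "partial s (\<lambda>y. f y v) x = (\<Sum>j=1..r. partial s (K j) x * (f0v v * V j v))" for s
  proof -
    have "((\<lambda>y. f y v) has_derivative
        (\<lambda>h. \<Sum>j=1..r. frechet_derivative (K j) (at x) h * (f0v v * V j v))) (at x)"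
      unfolding f_eq using K_differentiable
      by (auto intro!: derivative_eq_intros simp: frechet_derivative_works[symmetric])
    from partial_eqI[OF this] show ?thesis by (simp add: partial_def)
  qed
  have v_part: "partial s (f x) v = (\<Sum>j=1..r. K j x * partial s (\<lambda>w. f0v w * V j w) v)" for s
  proof -
    have "(f x has_derivative
        (\<lambda>h. \<Sum>j=1..r. K j x * frechet_derivative (\<lambda>w. f0v w * V j w) (at v) h)) (at v)"
      unfolding f_eq[abs_def]
      by (intro has_derivative_sum has_derivative_mult_right f0v_V_derivative assms)
    from partial_eqI[OF this] show ?thesis by (simp add: partial_def)
  qed
  have "rhs x v = (\<Sum>s\<in>UNIV. - (v $ s * partial s (\<lambda>y. f y v) x) + E x $ s * partial s (f x) v)"
    by (simp add: vp_rhs_def inner_vec_def sum.distrib sum_negf sum_subtractf)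
  also have "\<dots> = (\<Sum>n\<in>N. \<alpha> n x * \<beta> n v)"
    unfolding sum_N x_part v_part
    by (simp add: \<alpha>_def \<beta>_def sum_distrib_left sum.distrib sum_negf sum_subtractf algebra_simps)
  finally show ?thesis .
qed

lemma integrable_nth_V:
  assumes "in_L2 \<Omega>v f0v a" "j \<in> {1..r}"
  shows "set_integrable lborel \<Omega>v (\<lambda>v. a v * (v $ s * (f0v v * V j v)))"
  using vel.integrable_mult[OF assms(1) V_decay(1)[OF assms(2)], of s]
  by (simp add: mult.commute mult.left_commute)

lemma integrable_\<beta>:
  assumes "in_L2 \<Omega>v f0v a" "n \<in> N"
  shows "set_integrable lborel \<Omega>v (\<lambda>v. a v * \<beta> n v)"
proof -
  obtain s j b where n: "n = (s, j, b)" "j \<in> {1..r}" using N_cases[OF assms(2)] .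
  have "set_integrable lborel \<Omega>v (\<lambda>v. a v * partial s (\<lambda>w. f0v w * V j w) v)
      = set_integrable lborel \<Omega>v (\<lambda>v. f0v v * a v * (partial s (\<lambda>w. f0v w * V j w) v / f0v v))"
    using f0v_pos by (intro set_integrable_cong) force+
  then show ?thesis
    using integrable_nth_V[OF assms(1) n(2), of s] vel.integrable_mult[OF assms(1) V_decay(2)[OF n(2)], of s]
    by (cases b) (simp_all add: n(1) \<beta>_def)
qed

lemma moment_f:
  assumes "in_L2 \<Omega>v f0v a"
  shows "set_integrable lborel \<Omega>v (\<lambda>v. a v * f x v)"
    and "(LINT v:\<Omega>v|lborel. a v * f x v) = (\<Sum>j=1..r. K j x * inner_L2 \<Omega>v f0v a (V j))"
  using set_integral_lincomb[of \<Omega>v lborel "\<lambda>v. a v * f x v" "\<lambda>j. K j x" "\<lambda>j v. f0v v * a v * V j v" "{1..r}"]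
    vel.dom vel.integrable_mult[OF assms V_L2]
  by (auto simp: f_eq sum_distrib_left inner_L2_def algebra_simps)

lemma moment_rhs:
  assumes "in_L2 \<Omega>v f0v a"
  shows "set_integrable lborel \<Omega>v (\<lambda>v. a v * rhs x v)"
    and "moment a x = (\<Sum>n\<in>N. \<alpha> n x * (LINT v:\<Omega>v|lborel. a v * \<beta> n v))"
  using set_integral_lincomb[of \<Omega>v lborel "\<lambda>v. a v * rhs x v" "\<lambda>n. \<alpha> n x" "\<lambda>n v. a v * \<beta> n v" N]
    vel.dom integrable_\<beta>[OF assms]
  by (auto simp: rhs_eq sum_distrib_left moment_def algebra_simps)

lemma inner_moment:
  assumes h: "in_L2 (cbox lo hi) (\<lambda>x. 1) h" and a: "in_L2 \<Omega>v f0v a"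
  shows "set_integrable lborel (cbox lo hi) (\<lambda>x. h x * moment a x)"
    and "inner_L2 (cbox lo hi) (\<lambda>x. 1) h (moment a)
      = (\<Sum>n\<in>N. (LINT v:\<Omega>v|lborel. a v * \<beta> n v) * inner_L2 (cbox lo hi) (\<lambda>x. 1) h (\<alpha> n))"
  using set_integral_lincomb[of "cbox lo hi" lborel "\<lambda>x. h x * moment a x"
      "\<lambda>n. LINT v:\<Omega>v|lborel. a v * \<beta> n v" "\<lambda>n x. h x * \<alpha> n x" N]
    space.integrable_mult[OF h \<alpha>_L2]
  by (auto simp: moment_rhs[OF a] sum_distrib_left inner_L2_def algebra_simps)

text \<open>Testing the right-hand side against a product \<open>h a\<close> is testing its moment against \<open>h\<close>; by the
  finite rank, only integrals of products over a product domain occur.\<close>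

lemma inner_xv_rhs:
  assumes h: "in_L2 (cbox lo hi) (\<lambda>x. 1) h" and a: "in_L2 \<Omega>v f0v a"
    and F: "\<And>x v. v \<in> \<Omega>v \<Longrightarrow> F x v = rhs x v"
  shows "inner_xv lo hi \<Omega>v (\<lambda>x v. h x * a v) F = inner_L2 (cbox lo hi) (\<lambda>x. 1) h (moment a)"
proof -
  have h\<alpha>: "set_integrable lborel (cbox lo hi) (\<lambda>x. h x * \<alpha> n x)" for n
    using space.integrable_mult[OF h \<alpha>_L2, of n] by simp
  have "inner_xv lo hi \<Omega>v (\<lambda>x v. h x * a v) F
      = (\<Sum>n\<in>N. 1 * (LINT z:cbox lo hi \<times> \<Omega>v|lborel.
            (h (fst z) * \<alpha> n (fst z)) * (a (snd z) * \<beta> n (snd z))))"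
    unfolding inner_xv_def
  proof (rule set_integral_lincomb)
    show "cbox lo hi \<times> \<Omega>v \<in> sets lborel"
      using borel_Times[of "cbox lo hi" \<Omega>v] vel.dom by simp
    fix z assume "z \<in> cbox lo hi \<times> \<Omega>v"
    then have "snd z \<in> \<Omega>v" by auto
    then show "h (fst z) * a (snd z) * F (fst z) (snd z)
        = (\<Sum>n\<in>N. 1 * ((h (fst z) * \<alpha> n (fst z)) * (a (snd z) * \<beta> n (snd z))))"
      by (simp add: F rhs_eq sum_distrib_left algebra_simps)
  qed (intro set_integral_prod_mult h\<alpha> integrable_\<beta> a)
  also have "\<dots> = (\<Sum>n\<in>N. (LINT v:\<Omega>v|lborel. a v * \<beta> n v) * inner_L2 (cbox lo hi) (\<lambda>x. 1) h (\<alpha> n))"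
    using set_integral_prod_mult(2)[OF h\<alpha> integrable_\<beta>[OF a]]
    by (intro sum.cong refl) (simp add: inner_L2_def)
  finally show ?thesis by (simp add: inner_moment[OF h a])
qed

section \<open>One step of the integrator\<close>

text \<open>The augmented bases contain the old ones, so projecting the old solution loses nothing:
  the function \<open>g\<close> at which the Galerkin step evaluates the right-hand side is \<open>f\<close>.\<close>

lemma projected_solution_eq:
  assumes Xt: "orthonormal_family (cbox lo hi) (\<lambda>x. 1) {1..p} Xt"
      "\<And>i. i \<in> {1..r} \<Longrightarrow> X i \<in> fun_span UNIV (Xt ` {1..p})"
    and Vt: "orthonormal_family \<Omega>v f0v {1..q} Vt"
      "\<And>j. j \<in> {1..r} \<Longrightarrow> V j \<in> fun_span \<Omega>v (Vt ` {1..q})"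
    and v: "v \<in> \<Omega>v"
  shows "low_rank f0v p q Xt (S_proj lo hi \<Omega>v f0v r X S V Xt Vt) Vt x v = f x v"
proof -
  let ?M = "\<lambda>k i. inner_L2 (cbox lo hi) (\<lambda>x. 1) (Xt k) (X i)"
  let ?N = "\<lambda>j l. inner_L2 \<Omega>v f0v (V j) (Vt l)"
  have X: "X i x = (\<Sum>k=1..p. ?M k i * Xt k x)" if "i \<in> {1..r}" for i
    using space.orthonormal_expansion[OF Xt(1) _ Xt(2)[OF that]] by simp
  have V: "V j v = (\<Sum>l=1..q. ?N j l * Vt l v)" if "j \<in> {1..r}" for j
    using vel.orthonormal_expansion[OF Vt(1) _ Vt(2)[OF that] _ v]
    by (simp add: inner_L2_commute[of _ _ "V j"])
  have "(\<Sum>k=1..p. \<Sum>l=1..q. Xt k x * S_proj lo hi \<Omega>v f0v r X S V Xt Vt k l * Vt l v)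
      = (\<Sum>k=1..p. \<Sum>l=1..q. \<Sum>i=1..r. \<Sum>j=1..r. (?M k i * Xt k x) * S i j * (?N j l * Vt l v))"
    unfolding S_proj_def by (simp add: sum_distrib_left sum_distrib_right algebra_simps)
  also have "\<dots> = (\<Sum>i=1..r. \<Sum>j=1..r. (\<Sum>k=1..p. ?M k i * Xt k x) * S i j * (\<Sum>l=1..q. ?N j l * Vt l v))"
    by (subst sum_swap_pairs) (simp add: sum_distrib_left sum_distrib_right algebra_simps)
  also have "\<dots> = (\<Sum>i=1..r. \<Sum>j=1..r. X i x * S i j * V j v)"
    by (intro sum.cong refl) (simp add: X V)
  finally show ?thesis by (simp add: low_rank_def f)
qed


text \<open>What a step does to the first \<open>m\<close> columns: each of them makes an explicit Euler step, and the
  truncation leaves it unchanged. The remaining velocity functions stay in the span of those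
  members of the augmented basis that are orthogonal to \<open>U\<close>.\<close>

lemma dlr_step_K:
  assumes "dlr_step lo hi \<Omega>v f0v m r U \<tau> X S W X1 S1 W1"
  obtains q Wt Q where "m \<le> q" "orthonormal_family \<Omega>v f0v {1..q} (join_at m U Wt)"
    and "\<And>j v. j \<in> {m+1..r} \<Longrightarrow> v \<in> \<Omega>v \<Longrightarrow> W1 j v = (\<Sum>l=m+1..q. Wt l v * Q l j)"
    and "\<And>b x. b \<in> {1..m} \<Longrightarrow> (\<Sum>i=1..r. X1 i x * S1 i b) = K b x + \<tau> * moment (U b) x"
proof -
  obtain p q Xt Wt where
    Xt: "orthonormal_basis UNIV (cbox lo hi) (\<lambda>x. 1) {1..p} Xt
        (X ` {1..r} \<union> (\<Union>s. (\<lambda>i. partial s (X i)) ` {1..r}) \<union> K_step \<Omega>v r \<tau> X S V rhs ` {1..r})"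
    and mq: "m \<le> q"
    and Vt: "orthonormal_basis \<Omega>v \<Omega>v f0v {1..q} (join_at m U Wt)
        (U ` {1..m} \<union> L_step lo hi \<Omega>v f0v m r \<tau> X S V rhs ` {m+1..r} \<union> W ` {m+1..r})"
    and tr: "truncation lo hi \<Omega>v m r p q Xt
        (S_step lo hi \<Omega>v f0v r p q \<tau> X S V Xt (join_at m U Wt)) Wt X1 S1 W1"
    using assms unfolding dlr_step_def Let_def V[symmetric] f[symmetric] by blast
  define Vt where "Vt = join_at m U Wt"
  define St where "St = S_step lo hi \<Omega>v f0v r p q \<tau> X S V Xt Vt"
  define Kt where "Kt = (\<lambda>l x. \<Sum>k=1..p. Xt k x * St k l)"
  note tr = tr[folded Vt_def, folded St_def]
  have Xt_on: "orthonormal_family (cbox lo hi) (\<lambda>x. 1) {1..p} Xt"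
    and Vt_on: "orthonormal_family \<Omega>v f0v {1..q} Vt"
    using Xt Vt by (auto simp: orthonormal_basis_def Vt_def)
  have Xt_span: "X i \<in> fun_span UNIV (Xt ` {1..p})"
      "K_step \<Omega>v r \<tau> X S V rhs i \<in> fun_span UNIV (Xt ` {1..p})" if "i \<in> {1..r}" for i
    using Xt that unfolding orthonormal_basis_def by (auto intro!: fun_span_superset)
  have Vt_span: "V j \<in> fun_span \<Omega>v (Vt ` {1..q})" if "j \<in> {1..r}" for j
    using Vt that unfolding orthonormal_basis_def Vt_def V join_at_def
    by (auto intro!: fun_span_superset)
  let ?inner = "inner_L2 (cbox lo hi) (\<lambda>x. 1)"
  have Xt_L2: "in_L2 (cbox lo hi) (\<lambda>x. 1) (Xt k)" if "k \<in> {1..p}" for k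
    using Xt_on that by (simp add: orthonormal_family_def)
  have X_L2: "in_L2 (cbox lo hi) (\<lambda>x. 1) (X i)" if "i \<in> {1..r}" for i
    using X_smooth[OF that] C1_on_continuous[OF open_UNIV] continuous_on_subset
    by (blast intro: in_L2_continuous)
  \<comment> \<open>The column of the Galerkin step is the projection of \<open>K_step b\<close> to the span of \<open>Xt\<close>, which
    contains \<open>K_step b\<close> by construction.\<close>
  have Kt: "Kt b x = K b x + \<tau> * moment (U b) x" if b: "b \<in> {1..m}" for b x
  proof -
    have br: "b \<in> {1..r}" using b m_le by auto
    have U_L2: "in_L2 \<Omega>v f0v (U b)" using V_L2[OF br] V_fixed[OF b] by simp
    have Vt_b: "Vt b = U b" using b by (simp add: Vt_def join_at_def)
    define Kb where "Kb = (\<lambda>x. K b x + \<tau> * moment (U b) x)"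
    have Kb_step: "K_step \<Omega>v r \<tau> X S V rhs b = Kb"
      by (auto simp: fun_eq_iff K_step_def Kb_def K_def moment_def V_fixed[OF b])
    have St: "St k b = ?inner (Xt k) Kb" if k: "k \<in> {1..p}" for k
    proof -
      have K_lin: "set_integrable lborel (cbox lo hi) (\<lambda>x. Xt k x * K b x)"
          "?inner (Xt k) (K b) = (\<Sum>i=1..r. S i b * ?inner (Xt k) (X i))"
        using set_integral_lincomb[of "cbox lo hi" lborel "\<lambda>x. Xt k x * K b x" "\<lambda>i. S i b"
            "\<lambda>i x. Xt k x * X i x" "{1..r}"] space.integrable_mult[OF Xt_L2[OF k] X_L2]
        by (auto simp: K_def sum_distrib_left inner_L2_def algebra_simps)
      have "S_proj lo hi \<Omega>v f0v r X S V Xt Vt k b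
          = (\<Sum>i=1..r. \<Sum>j=1..r. if j = b then ?inner (Xt k) (X i) * S i j else 0)"
        unfolding S_proj_def Vt_b V_fixed[OF b, symmetric]
        by (intro sum.cong refl) (simp add: V_inner[OF _ br])
      also have "\<dots> = (\<Sum>i=1..r. S i b * ?inner (Xt k) (X i))"
        using br by (simp add: mult.commute)
      also have "\<dots> = ?inner (Xt k) (K b)"
        using K_lin(2) by simp
      finally have "S_proj lo hi \<Omega>v f0v r X S V Xt Vt k b = ?inner (Xt k) (K b)" .
      moreover have "inner_xv lo hi \<Omega>v (\<lambda>x v. Xt k x * Vt b v) (vp_rhs lo hi \<Omega>v
            (low_rank f0v p q Xt (S_proj lo hi \<Omega>v f0v r X S V Xt Vt) Vt))
          = ?inner (Xt k) (moment (U b))"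
        unfolding Vt_b
        by (intro inner_xv_rhs Xt_L2 k U_L2 vp_rhs_cong open_v
             projected_solution_eq[OF Xt_on Xt_span(1) Vt_on Vt_span])
      moreover have "?inner (Xt k) Kb = ?inner (Xt k) (K b) + \<tau> * ?inner (Xt k) (moment (U b))"
        using set_integral_add[of lborel "cbox lo hi" "\<lambda>x. Xt k x * K b x"
            "\<lambda>x. \<tau> * (Xt k x * moment (U b) x)"] K_lin(1) inner_moment(1)[OF Xt_L2[OF k] U_L2]
        by (simp add: inner_L2_def Kb_def algebra_simps)
      ultimately show ?thesis unfolding St_def S_step_def by simp
    qed
    have "Kb x = (\<Sum>k=1..p. ?inner (Xt k) Kb * Xt k x)"
      using space.orthonormal_expansion[OF Xt_on _ Xt_span(2)[OF br, unfolded Kb_step]] by simp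
    also have "\<dots> = Kt b x"
      unfolding Kt_def by (intro sum.cong refl) (simp add: St mult.commute)
    finally show ?thesis by (simp add: Kb_def)
  qed
  obtain Xcons Scons Xtrem P \<sigma> Q R where
    cons: "is_QR UNIV (cbox lo hi) (\<lambda>x. 1) {1..m} Kt Xcons Scons"
    and W1: "\<And>j v. j \<in> {m+1..r} \<Longrightarrow> v \<in> \<Omega>v \<Longrightarrow> W1 j v = (\<Sum>l=m+1..q. Wt l v * Q l j)"
    and qr: "is_QR UNIV (cbox lo hi) (\<lambda>x. 1) {1..r}
        (join_at m Xcons (\<lambda>j x. \<Sum>i=m+1..q. Xtrem i x * P i j)) X1 R"
    and S1: "\<And>i j. i \<in> {1..r} \<Longrightarrow> j \<in> {1..r} \<Longrightarrow> S1 i j = (\<Sum>k=1..r. R i k *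
        (if k \<le> m \<and> j \<le> m then Scons k j else if k = j then \<sigma> k else 0))"
    using tr unfolding truncation_def Let_def Kt_def[symmetric] by blast
  define J where "J = join_at m Xcons (\<lambda>j x. \<Sum>i=m+1..q. Xtrem i x * P i j)"
  have J: "J k x = (\<Sum>i=1..r. X1 i x * R i k)" if "k \<in> {1..r}" for k x
    using qr that unfolding is_QR_def J_def by blast
  \<comment> \<open>The middle factor is block diagonal, so for \<open>b \<le> m\<close> only the conservative block survives and
    the two QR decompositions multiply back to \<open>Kt b\<close>.\<close>
  have step: "(\<Sum>i=1..r. X1 i x * S1 i b) = K b x + \<tau> * moment (U b) x" if b: "b \<in> {1..m}" for b x
  proof -
    have br: "b \<in> {1..r}" using b m_le by auto
    have S1b: "S1 i b = (\<Sum>k=1..r. R i k * (if k \<le> m then Scons k b else 0))"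
      if "i \<in> {1..r}" for i
      unfolding S1[OF that br] using b by (intro sum.cong refl) auto
    have "(\<Sum>i=1..r. X1 i x * S1 i b)
        = (\<Sum>i=1..r. \<Sum>k=1..r. X1 i x * R i k * (if k \<le> m then Scons k b else 0))"
      by (intro sum.cong refl) (simp only: S1b sum_distrib_left mult.assoc)
    also have "\<dots> = (\<Sum>k=1..r. J k x * (if k \<le> m then Scons k b else 0))"
      by (subst sum.swap) (simp add: J sum_distrib_right)
    also have "\<dots> = (\<Sum>k=1..m. Xcons k x * Scons k b)"
      using m_le by (intro sum.mono_neutral_cong_right) (auto simp: J_def join_at_def)
    also have "\<dots> = Kt b x"
      using cons b unfolding is_QR_def by auto
    finally show ?thesis using Kt[OF b] by simp
  qed
  show ?thesis
    using that[OF mq Vt_on[unfolded Vt_def] W1 step] by blast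
qed

text \<open>In the moment against \<open>U\<^sub>b\<close> only column \<open>b\<close> contributes.\<close>

lemma dlr_step_moment_basis:
  assumes step: "dlr_step lo hi \<Omega>v f0v m r U \<tau> X S W X1 S1 W1"
    and f1: "f1 = low_rank f0v r r X1 S1 (join_at m U W1)" and b: "b \<in> {1..m}"
  shows "set_integrable lborel \<Omega>v (\<lambda>v. U b v * f1 x v)"
    and "(LINT v:\<Omega>v|lborel. U b v * f1 x v) = (LINT v:\<Omega>v|lborel. U b v * f x v) + \<tau> * moment (U b) x"
proof -
  obtain q Wt Q where mq: "m \<le> q" and Vt: "orthonormal_family \<Omega>v f0v {1..q} (join_at m U Wt)"
    and W1: "\<And>j v. j \<in> {m+1..r} \<Longrightarrow> v \<in> \<Omega>v \<Longrightarrow> W1 j v = (\<Sum>l=m+1..q. Wt l v * Q l j)"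
    and K1: "\<And>b x. b \<in> {1..m} \<Longrightarrow> (\<Sum>i=1..r. X1 i x * S1 i b) = K b x + \<tau> * moment (U b) x"
    by (rule dlr_step_K[OF step]) (rule that)
  define V1 where "V1 = join_at m U W1"
  have br: "b \<in> {1..r}" and bq: "b \<in> {1..q}" using b m_le mq by auto
  have U_L2: "in_L2 \<Omega>v f0v (U b)" using V_L2[OF br] V_fixed[OF b] by simp
  have Wt_L2: "in_L2 \<Omega>v f0v (Wt l)" and Wt_orth: "inner_L2 \<Omega>v f0v (U b) (Wt l) = 0"
    if "l \<in> {m+1..q}" for l
  proof -
    have l: "l \<in> {1..q}" "join_at m U Wt l = Wt l" "join_at m U Wt b = U b" "b \<noteq> l"
      using that b by (auto simp: join_at_def)
    show "in_L2 \<Omega>v f0v (Wt l)" "inner_L2 \<Omega>v f0v (U b) (Wt l) = 0"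
      using Vt bq l unfolding orthonormal_family_def by metis+
  qed
  have V1: "set_integrable lborel \<Omega>v (\<lambda>v. f0v v * U b v * V1 j v) \<and>
      inner_L2 \<Omega>v f0v (U b) (V1 j) = (if j = b then 1 else 0)" if j: "j \<in> {1..r}" for j
  proof (cases "j \<le> m")
    case True
    then have "V1 j = V j" by (simp add: V1_def V join_at_def)
    then show ?thesis
      using vel.integrable_mult[OF U_L2 V_L2[OF j]] V_inner[OF br j] V_fixed[OF b] by auto
  next
    case False
    then have j': "j \<in> {m+1..r}" using j by auto
    have "f0v v * U b v * V1 j v = (\<Sum>l=m+1..q. Q l j * (f0v v * U b v * Wt l v))" if "v \<in> \<Omega>v" for v
      using W1[OF j' that] False by (simp add: V1_def join_at_def sum_distrib_left algebra_simps)
    note lc = set_integral_lincomb[OF vel.dom this vel.integrable_mult[OF U_L2 Wt_L2]]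
    have "inner_L2 \<Omega>v f0v (U b) (V1 j) = (\<Sum>l=m+1..q. Q l j * inner_L2 \<Omega>v f0v (U b) (Wt l))"
      unfolding inner_L2_def by (rule lc(2))
    then show ?thesis using lc(1) Wt_orth False b by auto
  qed
  have f1_eq: "U b v * f1 x v = (\<Sum>j=1..r. (\<Sum>i=1..r. X1 i x * S1 i j) * (f0v v * U b v * V1 j v))" for v
    unfolding f1 low_rank_def V1_def[symmetric]
    by (subst sum.swap) (simp add: sum_distrib_left sum_distrib_right algebra_simps)
  note lc = set_integral_lincomb[OF vel.dom f1_eq conjunct1[OF V1]]
  show "set_integrable lborel \<Omega>v (\<lambda>v. U b v * f1 x v)" by (rule lc(1))
  have "(LINT v:\<Omega>v|lborel. U b v * f1 x v)
      = (\<Sum>j=1..r. (\<Sum>i=1..r. X1 i x * S1 i j) * inner_L2 \<Omega>v f0v (U b) (V1 j))"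
    using lc(2) unfolding inner_L2_def .
  also have "\<dots> = (\<Sum>j=1..r. if j = b then \<Sum>i=1..r. X1 i x * S1 i j else 0)"
    using V1 by (intro sum.cong) auto
  also have "\<dots> = K b x + \<tau> * moment (U b) x"
    using br K1[OF b] by simp
  also have "K b x = (\<Sum>j=1..r. if j = b then K j x else 0)"
    using br by simp
  also have "\<dots> = (\<Sum>j=1..r. K j x * inner_L2 \<Omega>v f0v (U b) (V j))"
    using V_inner[OF br] V_fixed[OF b] by (intro sum.cong) auto
  also have "\<dots> = (LINT v:\<Omega>v|lborel. U b v * f x v)"
    by (rule moment_f(2)[OF U_L2, symmetric])
  finally show "(LINT v:\<Omega>v|lborel. U b v * f1 x v)
      = (LINT v:\<Omega>v|lborel. U b v * f x v) + \<tau> * moment (U b) x" .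
qed

lemma dlr_step_moment:
  assumes step: "dlr_step lo hi \<Omega>v f0v m r U \<tau> X S W X1 S1 W1"
    and f1: "f1 = low_rank f0v r r X1 S1 (join_at m U W1)"
    and a: "\<And>v. v \<in> \<Omega>v \<Longrightarrow> a v = (\<Sum>b=1..m. \<kappa> b * U b v)"
  shows "(LINT v:\<Omega>v|lborel. a v * f1 x v) = (LINT v:\<Omega>v|lborel. a v * f x v) + \<tau> * moment a x"
proof -
  have U_L2: "in_L2 \<Omega>v f0v (U b)" if "b \<in> {1..m}" for b
    using V_L2[of b] V_fixed[OF that] that m_le by auto
  have expand: "(LINT v:\<Omega>v|lborel. a v * h v) = (\<Sum>b=1..m. \<kappa> b * (LINT v:\<Omega>v|lborel. U b v * h v))"
    if "\<And>b. b \<in> {1..m} \<Longrightarrow> set_integrable lborel \<Omega>v (\<lambda>v. U b v * h v)" for h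
    using that by (intro set_integral_lincomb(2) vel.dom)
       (simp_all add: a sum_distrib_right mult.assoc)
  have "(LINT v:\<Omega>v|lborel. a v * f1 x v)
      = (\<Sum>b=1..m. \<kappa> b * ((LINT v:\<Omega>v|lborel. U b v * f x v) + \<tau> * moment (U b) x))"
    using expand[OF dlr_step_moment_basis(1)[OF step f1]] dlr_step_moment_basis(2)[OF step f1]
    by (auto intro!: sum.cong)
  also have "\<dots> = (\<Sum>b=1..m. \<kappa> b * (LINT v:\<Omega>v|lborel. U b v * f x v))
      + \<tau> * (\<Sum>b=1..m. \<kappa> b * moment (U b) x)"
    by (simp add: algebra_simps sum.distrib sum_distrib_left)
  also have "\<dots> = (LINT v:\<Omega>v|lborel. a v * f x v) + \<tau> * moment a x"
    using expand[OF moment_f(1)[OF U_L2]] expand[OF moment_rhs(1)[OF U_L2]]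
    by (simp add: moment_def)
  finally show ?thesis .
qed

text \<open>The transport term yields the energy flux; the field term yields the work of the field on the
  current, since \<open>\<integral> (v\<^sup>2/2) \<partial>\<^sub>s f dv = - \<integral> v\<^sub>s f dv\<close>.\<close>

lemma energy_moment:
  assumes L2: "in_L2 \<Omega>v f0v (\<lambda>v. (norm v)\<^sup>2)" "in_L2 \<Omega>v f0v (\<lambda>v. 1)"
    and ibp: "\<And>j. j \<in> {1..r} \<Longrightarrow> ibp_no_boundary \<Omega>v (\<lambda>v. (norm v)\<^sup>2) (\<lambda>v. f0v v * V j v)"
  shows "1/2 * moment (\<lambda>v. (norm v)\<^sup>2) x
      = - divergence (energy_flux \<Omega>v f) x - E x \<bullet> current \<Omega>v f x"
proof -
  define q where "q s j = (LINT v:\<Omega>v|lborel. (norm v)\<^sup>2 * (v $ s * (f0v v * V j v)))" for s j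
  define c where "c s j = (LINT v:\<Omega>v|lborel. v $ s * (f0v v * V j v))" for s j
  have flux: "energy_flux \<Omega>v f x $ s = (1/2) * (\<Sum>j=1..r. K j x * q s j)" for x s
  proof -
    have "(norm v)\<^sup>2 * f x v * v $ s
        = (\<Sum>j=1..r. K j x * ((norm v)\<^sup>2 * (v $ s * (f0v v * V j v))))" for s v
      by (simp add: f_eq sum_distrib_left sum_distrib_right algebra_simps)
    note lc = set_integral_lincomb[OF vel.dom this integrable_nth_V[OF L2(1)], folded q_def]
    show ?thesis
      unfolding energy_flux_def using set_integral_scaleR_vec_nth[OF lc(1)] lc(2) by simp
  qed
  have cur: "current \<Omega>v f x $ s = (\<Sum>j=1..r. K j x * c s j)" for s
  proof -
    have "f x v * v $ s = (\<Sum>j=1..r. K j x * (v $ s * (f0v v * V j v)))" for s v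
      by (simp add: f_eq sum_distrib_left sum_distrib_right algebra_simps)
    note lc = set_integral_lincomb[OF vel.dom this integrable_nth_V[OF L2(2), unfolded mult_1],
        folded c_def]
    show ?thesis
      unfolding current_def using set_integral_scaleR_vec_nth[OF lc(1)] lc(2) by simp
  qed
  have div: "partial s (\<lambda>y. energy_flux \<Omega>v f y $ s) x = (1/2) * (\<Sum>j=1..r. partial s (K j) x * q s j)" for s
  proof -
    have "((\<lambda>y. (1/2) * (\<Sum>j=1..r. K j y * q s j)) has_derivative
        (\<lambda>h. (1/2) * (\<Sum>j=1..r. frechet_derivative (K j) (at x) h * q s j))) (at x)"
      using K_differentiable
      by (auto intro!: derivative_eq_intros simp: frechet_derivative_works[symmetric])
    from partial_eqI[OF this] show ?thesis by (simp add: flux partial_def)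
  qed
  have norm_partial: "partial s (\<lambda>v. (norm v)\<^sup>2) v = 2 * v $ s" for s and v :: "real^'d"
  proof -
    have "((\<lambda>v. v \<bullet> v) has_derivative (\<lambda>h. v \<bullet> h + h \<bullet> v)) (at v)"
      by (auto intro!: derivative_eq_intros)
    from partial_eqI[OF this, of s] show ?thesis
      by (simp add: power2_norm_eq_inner inner_axis inner_axis')
  qed
  have "(LINT v:\<Omega>v|lborel. (norm v)\<^sup>2 * \<beta> (s, j, False) v) = - 2 * c s j" if "j \<in> {1..r}" for s j
    using ibp[OF that] unfolding ibp_no_boundary_def norm_partial
    by (simp add: \<beta>_def c_def mult.assoc)
  moreover have "(LINT v:\<Omega>v|lborel. (norm v)\<^sup>2 * \<beta> (s, j, True) v) = q s j" for s j
    by (simp add: \<beta>_def q_def)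
  ultimately have "moment (\<lambda>v. (norm v)\<^sup>2) x
      = (\<Sum>s\<in>UNIV. \<Sum>j=1..r. - partial s (K j) x * q s j + E x $ s * K j x * (- 2 * c s j))"
    unfolding moment_rhs(2)[OF L2(1)] sum_N
    by (intro sum.cong refl) (simp add: \<alpha>_def)
  also have "\<dots> = (\<Sum>s\<in>UNIV. - (\<Sum>j=1..r. partial s (K j) x * q s j)
      - 2 * (E x $ s * (\<Sum>j=1..r. K j x * c s j)))"
    by (intro sum.cong refl) (simp add: sum.distrib sum_negf sum_subtractf sum_distrib_left algebra_simps)
  finally show ?thesis
    by (simp add: divergence_def div inner_vec_def cur sum_subtractf sum_negf
        flip: sum_distrib_left sum_divide_distrib)
qed

end

section \<open>The field of a perturbed density\<close>

lemma C1_on_lincomb: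
  assumes "C1_on UNIV f" "C1_on UNIV g"
  shows "C1_on UNIV (\<lambda>x. a * f x + b * g x)"
    and "partial s (\<lambda>x. a * f x + b * g x) = (\<lambda>x. a * partial s f x + b * partial s g x)"
proof -
  have D: "((\<lambda>x. a * f x + b * g x) has_derivative
      (\<lambda>h. a * frechet_derivative f (at x) h + b * frechet_derivative g (at x) h)) (at x)" for x
    using assms
    by (intro has_derivative_add has_derivative_mult_right)
       (simp_all add: C1_on_def frechet_derivative_works[symmetric])
  show P: "partial s (\<lambda>x. a * f x + b * g x) = (\<lambda>x. a * partial s f x + b * partial s g x)" for s
    using partial_eqI[OF D] by (simp add: fun_eq_iff partial_def)
  have "continuous_on UNIV (\<lambda>x. \<chi> s. partial s (\<lambda>x. a * f x + b * g x) x)"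
    unfolding P using assms by (intro continuous_intros C1_on_continuous_partial)
  then show "C1_on UNIV (\<lambda>x. a * f x + b * g x)"
    using D by (auto simp: C1_on_def grad_def[abs_def] differentiable_def)
qed

lemma C2_on_lincomb:
  assumes "C2_on UNIV f" "C2_on UNIV g"
  shows "C2_on UNIV (\<lambda>x. a * f x + b * g x)"
    and "divergence (grad (\<lambda>x. a * f x + b * g x)) x
      = a * divergence (grad f) x + b * divergence (grad g) x"
proof -
  have C1: "C1_on UNIV f" "C1_on UNIV g" "C1_on UNIV (partial s f)" "C1_on UNIV (partial s g)" for s
    using assms by (auto simp: C2_on_def)
  show "C2_on UNIV (\<lambda>x. a * f x + b * g x)"
    unfolding C2_on_def C1_on_lincomb(2)[OF C1(1,2)] using C1_on_lincomb(1) C1 by blast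
  show "divergence (grad (\<lambda>x. a * f x + b * g x)) x
      = a * divergence (grad f) x + b * divergence (grad g) x"
    by (simp add: divergence_def C1_on_lincomb(2)[OF C1(1,2)] C1_on_lincomb(2)[OF C1(3,4)]
        sum.distrib sum_distrib_left)
qed

text \<open>Density perturbations \<open>t H\<close> change the field by increments proportional to \<open>t\<close>: a
  combination of the potentials is periodic and harmonic.\<close>

lemma efield_increment_unique:
  fixes lo hi :: "real^'d::finite"
  assumes box: "\<And>s. lo $ s < hi $ s"
    and E: "is_efield lo hi \<Omega>v f E" "is_efield lo hi \<Omega>v f1 E1" "is_efield lo hi \<Omega>v f2 E2"
    and \<rho>1: "\<And>x. (LINT v:\<Omega>v|lborel. f1 x v) = (LINT v:\<Omega>v|lborel. f x v) + t1 * H x"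
    and \<rho>2: "\<And>x. (LINT v:\<Omega>v|lborel. f2 x v) = (LINT v:\<Omega>v|lborel. f x v) + t2 * H x"
  shows "t2 *\<^sub>R (E1 x - E x) = t1 *\<^sub>R (E2 x - E x)"
proof -
  obtain \<phi> where \<phi>: "C2_on UNIV \<phi>" "box_periodic lo hi \<phi>" "\<And>x. E x = - grad \<phi> x"
      "\<And>x. - divergence (grad \<phi>) x = 1 - (LINT v:\<Omega>v|lborel. f x v)"
    using E(1) unfolding is_efield_def by blast
  obtain \<phi>1 where \<phi>1: "C2_on UNIV \<phi>1" "box_periodic lo hi \<phi>1" "\<And>x. E1 x = - grad \<phi>1 x"
      "\<And>x. - divergence (grad \<phi>1) x = 1 - (LINT v:\<Omega>v|lborel. f1 x v)"
    using E(2) unfolding is_efield_def by blast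
  obtain \<phi>2 where \<phi>2: "C2_on UNIV \<phi>2" "box_periodic lo hi \<phi>2" "\<And>x. E2 x = - grad \<phi>2 x"
      "\<And>x. - divergence (grad \<phi>2) x = 1 - (LINT v:\<Omega>v|lborel. f2 x v)"
    using E(3) unfolding is_efield_def by blast
  define w where "w = (\<lambda>x. t2 * \<phi>1 x + (- t1) * \<phi>2 x)"
  define u where "u = (\<lambda>x. 1 * w x + (t1 - t2) * \<phi> x)"
  have C2w: "C2_on UNIV w" unfolding w_def by (intro C2_on_lincomb \<phi>1 \<phi>2)
  have C2u: "C2_on UNIV u" unfolding u_def by (intro C2_on_lincomb C2w \<phi>)
  have C1: "C1_on UNIV w" "C1_on UNIV \<phi>" "C1_on UNIV \<phi>1" "C1_on UNIV \<phi>2"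
    using C2w \<phi>(1) \<phi>1(1) \<phi>2(1) by (auto simp: C2_on_def)
  have "divergence (grad u) x = t2 * divergence (grad \<phi>1) x - t1 * divergence (grad \<phi>2) x
      + (t1 - t2) * divergence (grad \<phi>) x" for x
    unfolding u_def C2_on_lincomb(2)[OF C2w \<phi>(1)] unfolding w_def C2_on_lincomb(2)[OF \<phi>1(1) \<phi>2(1)]
    by simp
  moreover have "divergence (grad \<phi>1) x = divergence (grad \<phi>) x + t1 * H x"
      "divergence (grad \<phi>2) x = divergence (grad \<phi>) x + t2 * H x" for x
    using \<phi>(4)[of x] \<phi>1(4)[of x] \<phi>2(4)[of x] \<rho>1[of x] \<rho>2[of x] by linarith+
  ultimately have harm: "divergence (grad u) x = 0" for x
    by (simp add: algebra_simps)
  have per: "box_periodic lo hi u"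
    using \<phi>(2) \<phi>1(2) \<phi>2(2) by (simp add: box_periodic_def u_def w_def)
  have "t2 * partial s \<phi>1 x - t1 * partial s \<phi>2 x + (t1 - t2) * partial s \<phi> x = 0" for s
    using periodic_harmonic_partial_zero[OF box per C2u harm, of s x]
    unfolding u_def C1_on_lincomb(2)[OF C1(1,2)] unfolding w_def C1_on_lincomb(2)[OF C1(3,4)]
    by simp
  then have "t2 * (E1 x - E x) $ s = t1 * (E2 x - E x) $ s" for s
    by (simp add: \<phi>(3) \<phi>1(3) \<phi>2(3) algebra_simps)
  then show ?thesis by (simp add: vec_eq_iff)
qed

lemma is_efield_bounded:
  fixes lo hi :: "real^'d::finite"
  assumes box: "\<And>s. lo $ s < hi $ s" and E: "is_efield lo hi \<Omega>v f E"
  shows "\<exists>B. \<forall>x. norm (E x) \<le> B"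
proof -
  obtain \<phi> where \<phi>: "C2_on UNIV \<phi>" "box_periodic lo hi \<phi>" "\<And>x. E x = - grad \<phi> x"
    using E unfolding is_efield_def by blast
  have "\<exists>b. \<forall>x. \<bar>partial s \<phi> x\<bar> \<le> b" for s
  proof -
    have "box_periodic lo hi (partial s \<phi>)" "continuous_on UNIV (partial s \<phi>)"
      using \<phi>(1,2) by (auto simp: C2_on_def C1_on_def intro: box_periodic_partial C1_on_continuous_partial)
    then show ?thesis using box_periodic_bounded[OF box] by metis
  qed
  then obtain b where b: "\<And>s x. \<bar>partial s \<phi> x\<bar> \<le> b s" by metis
  have "norm (E x) \<le> (\<Sum>s\<in>UNIV. b s)" for x
    using norm_le_l1_cart[of "E x"] sum_mono[of UNIV "\<lambda>s. \<bar>E x $ s\<bar>" b] b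
    by (force simp: \<phi>(3))
  then show ?thesis by blast
qed

section \<open>The energy balance\<close>

text \<open>The norms by which the conserved functions are divided cannot vanish: otherwise division by
  zero would make a normalized function zero.\<close>

lemma conserved_basis_expansions:
  fixes \<Omega>v :: "(real^'d::finite) set"
  assumes U: "conserved_basis \<Omega>v f0v idx c U" and dom: "\<Omega>v \<in> sets lborel"
    and m: "CARD('d) + 2 \<le> m"
    and on: "\<And>b. b \<in> {1..m} \<Longrightarrow> inner_L2 \<Omega>v f0v (U b) (U b) = 1"
  obtains \<kappa>1 \<kappa>2 where "\<And>v. v \<in> \<Omega>v \<Longrightarrow> 1 = (\<Sum>b=1..m. \<kappa>1 b * U b v)"
    and "\<And>v. v \<in> \<Omega>v \<Longrightarrow> (norm v)\<^sup>2 = (\<Sum>b=1..m. \<kappa>2 b * U b v)"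
proof -
  define d where "d = CARD('d)"
  have d: "d > 0" "d + 2 \<le> m" using m by (auto simp: d_def)
  define n1 where "n1 = norm_L2 \<Omega>v f0v (\<lambda>v. 1)"
  define n2 where "n2 = norm_L2 \<Omega>v f0v (\<lambda>v. (norm v)\<^sup>2 - c)"
  have U1: "U 1 v = 1 / n1" and U2: "U (d + 2) v = ((norm v)\<^sup>2 - c) / n2" if "v \<in> \<Omega>v" for v
    using U that by (auto simp: conserved_basis_def n1_def n2_def d_def)
  have vanish: "inner_L2 \<Omega>v f0v a a = 0" if "\<And>v. v \<in> \<Omega>v \<Longrightarrow> a v = 0" for a
  proof -
    have "inner_L2 \<Omega>v f0v a a = inner_L2 \<Omega>v f0v (\<lambda>_. 0) (\<lambda>_. 0)"
      using that by (intro inner_L2_cong dom) simp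
    then show ?thesis by (simp add: inner_L2_def)
  qed
  have n1: "n1 \<noteq> 0"
  proof
    assume "n1 = 0"
    then have "inner_L2 \<Omega>v f0v (U 1) (U 1) = 0" using U1 by (intro vanish) simp
    then show False using on[of 1] d by simp
  qed
  have n2: "n2 \<noteq> 0"
  proof
    assume "n2 = 0"
    then have "inner_L2 \<Omega>v f0v (U (d + 2)) (U (d + 2)) = 0" using U2 by (intro vanish) simp
    then show False using on[of "d + 2"] d by simp
  qed
  have sum1: "(\<Sum>b=1..m. (if b = 1 then t else 0) * U b v) = t * U 1 v" for t v
    using d sum.delta[of "{1..m}" 1 "\<lambda>b. t * U b v"]
    by (simp add: if_distrib[where f = "\<lambda>x. x * _"] cong: if_cong)
  have sum2: "(\<Sum>b=1..m. (if b = d + 2 then t else 0) * U b v) = t * U (d + 2) v" for t v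
    using d sum.delta[of "{1..m}" "d + 2" "\<lambda>b. t * U b v"]
    by (simp add: if_distrib[where f = "\<lambda>x. x * _"] cong: if_cong)
  show ?thesis
  proof (rule that)
    fix v assume v: "v \<in> \<Omega>v"
    show "1 = (\<Sum>b=1..m. (if b = 1 then n1 else 0) * U b v)"
      unfolding sum1 U1[OF v] using n1 by simp
    show "(norm v)\<^sup>2 = (\<Sum>b=1..m. ((if b = 1 then c * n1 else 0) + (if b = d + 2 then n2 else 0)) * U b v)"
      unfolding distrib_right sum.distrib sum1 sum2 U1[OF v] U2[OF v] using n1 n2 by simp
  qed
qed

theorem theorem3:
  fixes lo hi :: "real^'d::finite"
    and \<Omega>v :: "(real^'d) set"
    and f0v :: "real^'d \<Rightarrow> real"
    and idx :: "nat \<Rightarrow> 'd"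
    and c :: real
    and m r :: nat
    and X U W V :: "nat \<Rightarrow> real^'d \<Rightarrow> real"
    and S :: "nat \<Rightarrow> nat \<Rightarrow> real"
    and f :: "real^'d \<Rightarrow> real^'d \<Rightarrow> real"
  assumes box: "\<And>s. lo $ s < hi $ s"
    and open_v: "open \<Omega>v"
    and f0v_pos: "\<And>v. v \<in> \<Omega>v \<Longrightarrow> f0v v > 0"
    and f0v_smooth: "C1_on \<Omega>v f0v"
    and f0v_decay: "in_L2 \<Omega>v f0v (\<lambda>v. 1)" "\<And>s. in_L2 \<Omega>v f0v (\<lambda>v. v $ s)"
          "in_L2 \<Omega>v f0v (\<lambda>v. (norm v)\<^sup>2)"
    and m_ge: "CARD('d) + 2 \<le> m" and m_le: "m \<le> r"
    and U: "conserved_basis \<Omega>v f0v idx c U"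
    and V: "V = join_at m U W"
    and f: "f = low_rank f0v r r X S V"
    and X_orth: "orthonormal_family (cbox lo hi) (\<lambda>x. 1) {1..r} X"
    and V_orth: "orthonormal_family \<Omega>v f0v {1..r} V"
    and X_smooth: "\<And>i. i \<in> {1..r} \<Longrightarrow> C1_on UNIV (X i)"
    and X_periodic: "\<And>i. i \<in> {1..r} \<Longrightarrow> box_periodic lo hi (X i)"
    and V_smooth: "\<And>j. j \<in> {1..r} \<Longrightarrow> C1_on \<Omega>v (V j)"
    and V_decay: "\<And>j s. j \<in> {1..r} \<Longrightarrow> in_L2 \<Omega>v f0v (\<lambda>v. v $ s * V j v)"
          "\<And>j s. j \<in> {1..r} \<Longrightarrow>
             in_L2 \<Omega>v f0v (\<lambda>v. partial s (\<lambda>w. f0v w * V j w) v / f0v v)"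
    and V_boundary: "\<And>j a. j \<in> {1..r} \<Longrightarrow>
             a \<in> {\<lambda>v. 1, \<lambda>v. (norm v)\<^sup>2} \<union> range (\<lambda>s v. v $ s) \<Longrightarrow>
             ibp_no_boundary \<Omega>v a (\<lambda>v. f0v v * V j v)"
    and neutral: "(LINT z:(cbox lo hi \<times> \<Omega>v)|lborel. f (fst z) (snd z)) = measure lborel (cbox lo hi)"
    and field: "poisson_solvable lo hi \<Omega>v f"
  shows "(\<forall>\<tau> X1 S1 W1 f1 E0 E1 x.
            0 < \<tau> \<and> dlr_step lo hi \<Omega>v f0v m r U \<tau> X S W X1 S1 W1 \<and>
            f1 = low_rank f0v r r X1 S1 (join_at m U W1) \<and> poisson_solvable lo hi \<Omega>v f1 \<and>
            E0 = efield lo hi \<Omega>v f \<and> E1 = efield lo hi \<Omega>v f1 \<longrightarrow>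
              (energy_density lo hi \<Omega>v f1 x - energy_density lo hi \<Omega>v f x) / \<tau>
                + divergence (energy_flux \<Omega>v f) x
                - E0 x \<bullet> ((1 / \<tau>) *\<^sub>R (E1 x - E0 x) - current \<Omega>v f x)
              = (norm (E1 x - E0 x))\<^sup>2 / (2 * \<tau>))
       \<and> (\<exists>C \<tau>0. 0 < \<tau>0 \<and> (\<forall>\<tau> X1 S1 W1 f1 E0 E1 x.
            0 < \<tau> \<and> \<tau> < \<tau>0 \<and> dlr_step lo hi \<Omega>v f0v m r U \<tau> X S W X1 S1 W1 \<and>
            f1 = low_rank f0v r r X1 S1 (join_at m U W1) \<and> poisson_solvable lo hi \<Omega>v f1 \<and>
            E0 = efield lo hi \<Omega>v f \<and> E1 = efield lo hi \<Omega>v f1 \<longrightarrow>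
              \<bar>(norm (E1 x - E0 x))\<^sup>2 / (2 * \<tau>)\<bar> \<le> C * \<tau>))"
proof -
  interpret low_rank_state lo hi \<Omega>v f0v m r X U W V S f
    using open_v f0v_pos f0v_smooth m_le V f V_orth X_smooth V_smooth V_decay field
    by unfold_locales
  have "inner_L2 \<Omega>v f0v (U b) (U b) = 1" if "b \<in> {1..m}" for b
    using V_inner[of b b] V_fixed[OF that] that m_le by auto
  then obtain \<kappa>1 \<kappa>2 where
    \<kappa>1: "\<And>v. v \<in> \<Omega>v \<Longrightarrow> 1 = (\<Sum>b=1..m. \<kappa>1 b * U b v)" and
    \<kappa>2: "\<And>v. v \<in> \<Omega>v \<Longrightarrow> (norm v)\<^sup>2 = (\<Sum>b=1..m. \<kappa>2 b * U b v)"
    using conserved_basis_expansions[OF U vel.dom m_ge] by metis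
  have density: "(LINT v:\<Omega>v|lborel. f1 x v) = (LINT v:\<Omega>v|lborel. f x v) + \<tau> * moment (\<lambda>v. 1) x"
    if "dlr_step lo hi \<Omega>v f0v m r U \<tau> X S W X1 S1 W1"
      "f1 = low_rank f0v r r X1 S1 (join_at m U W1)" for \<tau> X1 S1 W1 f1 x
    using dlr_step_moment[OF that \<kappa>1] by simp
  have energy: "(energy_density lo hi \<Omega>v f1 x - energy_density lo hi \<Omega>v f x) / \<tau>
        + divergence (energy_flux \<Omega>v f) x
        - E x \<bullet> ((1 / \<tau>) *\<^sub>R (efield lo hi \<Omega>v f1 x - E x) - current \<Omega>v f x)
      = (norm (efield lo hi \<Omega>v f1 x - E x))\<^sup>2 / (2 * \<tau>)"
    if \<tau>: "0 < \<tau>" and step: "dlr_step lo hi \<Omega>v f0v m r U \<tau> X S W X1 S1 W1"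
      "f1 = low_rank f0v r r X1 S1 (join_at m U W1)" for \<tau> X1 S1 W1 f1 x
  proof -
    define E1 where "E1 = efield lo hi \<Omega>v f1"
    have mom: "1/2 * moment (\<lambda>v. (norm v)\<^sup>2) x
        = - divergence (energy_flux \<Omega>v f) x - E x \<bullet> current \<Omega>v f x"
      using V_boundary by (intro energy_moment f0v_decay) blast
    have "energy_density lo hi \<Omega>v f1 x - energy_density lo hi \<Omega>v f x
        = \<tau> * (1/2 * moment (\<lambda>v. (norm v)\<^sup>2) x)
          + ((norm (E1 x))\<^sup>2 - (norm (E x))\<^sup>2) / 2"
      using dlr_step_moment[OF step \<kappa>2, of x]
      by (simp add: energy_density_def E1_def add_divide_distrib diff_divide_distrib algebra_simps)
    moreover have "(norm (E1 x))\<^sup>2 - (norm (E x))\<^sup>2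
        = (norm (E1 x - E x))\<^sup>2 + 2 * (E x \<bullet> (E1 x - E x))"
      by (simp add: power2_norm_eq_inner inner_diff_left inner_diff_right inner_commute)
    ultimately have increment: "energy_density lo hi \<Omega>v f1 x - energy_density lo hi \<Omega>v f x
        = \<tau> * (- divergence (energy_flux \<Omega>v f) x - E x \<bullet> current \<Omega>v f x)
          + ((norm (E1 x - E x))\<^sup>2 + 2 * (E x \<bullet> (E1 x - E x))) / 2"
      unfolding mom by simp
    show ?thesis
      unfolding E1_def[symmetric] increment inner_diff_right[of "E x" "(1 / \<tau>) *\<^sub>R _"] inner_scaleR_right
      using \<tau> by (simp add: add_divide_distrib diff_divide_distrib)
  qed
  \<comment> \<open>The field increment of any step is a multiple of that of one reference step, so that
    \<open>C\<close> may be read off from the latter; without a reference step the claim is void.\<close>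
  have order: "\<exists>C. \<forall>\<tau> X1 S1 W1 f1 x.
      0 < \<tau> \<and> dlr_step lo hi \<Omega>v f0v m r U \<tau> X S W X1 S1 W1 \<and>
      f1 = low_rank f0v r r X1 S1 (join_at m U W1) \<and> poisson_solvable lo hi \<Omega>v f1 \<longrightarrow>
      \<bar>(norm (efield lo hi \<Omega>v f1 x - E x))\<^sup>2 / (2 * \<tau>)\<bar> \<le> C * \<tau>"
  proof (cases "\<exists>t X2 S2 W2. 0 < t \<and> dlr_step lo hi \<Omega>v f0v m r U t X S W X2 S2 W2 \<and>
      poisson_solvable lo hi \<Omega>v (low_rank f0v r r X2 S2 (join_at m U W2))")
    case True
    then obtain t X2 S2 W2 f2 where t: "0 < t"
      and step2: "dlr_step lo hi \<Omega>v f0v m r U t X S W X2 S2 W2"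
        "f2 = low_rank f0v r r X2 S2 (join_at m U W2)"
      and field2: "poisson_solvable lo hi \<Omega>v f2" by blast
    obtain B where B: "\<And>x. norm (E x) \<le> B"
      using is_efield_bounded[OF box poisson_solvable_efield[OF field]] by blast
    obtain B2 where B2: "\<And>x. norm (efield lo hi \<Omega>v f2 x) \<le> B2"
      using is_efield_bounded[OF box poisson_solvable_efield[OF field2]] by blast
    show ?thesis
    proof (intro exI[of _ "(B2 + B)\<^sup>2 / (2 * t\<^sup>2)"] allI impI, elim conjE)
      fix \<tau> X1 S1 W1 f1 x
      assume \<tau>: "0 < \<tau>" and step1: "dlr_step lo hi \<Omega>v f0v m r U \<tau> X S W X1 S1 W1"
        "f1 = low_rank f0v r r X1 S1 (join_at m U W1)" and field1: "poisson_solvable lo hi \<Omega>v f1"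
      let ?D1 = "efield lo hi \<Omega>v f1 x - E x" and ?D2 = "efield lo hi \<Omega>v f2 x - E x"
      have "t *\<^sub>R ?D1 = \<tau> *\<^sub>R ?D2"
        by (rule efield_increment_unique[OF box poisson_solvable_efield[OF field]
              poisson_solvable_efield[OF field1] poisson_solvable_efield[OF field2]
              density[OF step1] density[OF step2]])
      then have "norm (t *\<^sub>R ?D1) = norm (\<tau> *\<^sub>R ?D2)" by simp
      then have "t * norm ?D1 = \<tau> * norm ?D2" using t \<tau> by simp
      also have "\<dots> \<le> \<tau> * (B2 + B)"
        using \<tau> norm_triangle_ineq4[of "efield lo hi \<Omega>v f2 x" "E x"] B[of x] B2[of x]
        by (intro mult_left_mono) linarith+
      finally have "norm ?D1 \<le> \<tau> * (B2 + B) / t" using t by (simp add: field_simps)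
      then have "(norm ?D1)\<^sup>2 \<le> (\<tau> * (B2 + B) / t)\<^sup>2"
        by (intro power_mono) auto
      then have "(norm ?D1)\<^sup>2 / (2 * \<tau>) \<le> (\<tau> * (B2 + B) / t)\<^sup>2 / (2 * \<tau>)"
        using \<tau> by (intro divide_right_mono) auto
      also have "\<dots> = (B2 + B)\<^sup>2 / (2 * t\<^sup>2) * \<tau>"
        using \<tau> t by (simp add: power2_eq_square field_simps)
      finally show "\<bar>(norm ?D1)\<^sup>2 / (2 * \<tau>)\<bar> \<le> (B2 + B)\<^sup>2 / (2 * t\<^sup>2) * \<tau>"
        using \<tau> by simp
    qed
  next
    case False
    then show ?thesis by blast
  qed
  show ?thesis
  proof (intro conjI)
    show "\<exists>C \<tau>0. 0 < \<tau>0 \<and> (\<forall>\<tau> X1 S1 W1 f1 E0 E1 x.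
            0 < \<tau> \<and> \<tau> < \<tau>0 \<and> dlr_step lo hi \<Omega>v f0v m r U \<tau> X S W X1 S1 W1 \<and>
            f1 = low_rank f0v r r X1 S1 (join_at m U W1) \<and> poisson_solvable lo hi \<Omega>v f1 \<and>
            E0 = efield lo hi \<Omega>v f \<and> E1 = efield lo hi \<Omega>v f1 \<longrightarrow>
              \<bar>(norm (E1 x - E0 x))\<^sup>2 / (2 * \<tau>)\<bar> \<le> C * \<tau>)"
    proof -
      obtain C where "\<forall>\<tau> X1 S1 W1 f1 x.
          0 < \<tau> \<and> dlr_step lo hi \<Omega>v f0v m r U \<tau> X S W X1 S1 W1 \<and>
          f1 = low_rank f0v r r X1 S1 (join_at m U W1) \<and> poisson_solvable lo hi \<Omega>v f1 \<longrightarrow>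
          \<bar>(norm (efield lo hi \<Omega>v f1 x - E x))\<^sup>2 / (2 * \<tau>)\<bar> \<le> C * \<tau>"
        using order by blast
      then show ?thesis by (intro exI[of _ C] exI[of _ "1::real"]) simp
    qed
  qed (use energy in auto)
qed

end
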